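(* Let $n\ge3$ and let $W=\operatorname{Span}\{g_0h_0,g_1h_1,g_2h_2\}\subseteq R_{(1,n)}$ be a basepoint free three-dimensional subspace, with $g_i$ of bidegree $(1,1)$ and the $h_i$ a pencil of bidegree $(0,n-1)$, so that $I_W=\langle g_0h_0,\,g_1h_1,\,g_2(ah_0+bh_1)\rangle$ for some constants $a,b\in\mathbb K$. If $\mathbb P(W)\cap\Sigma_{1,n}$ is empty and $\mathbb P(W)\cap\Sigma'_{3,n-1}$ contains three noncollinear points, then $I_W$ has minimal first syzygies of bidegrees $$(1,3n),\quad(2,2n)\ \text{(three of them)},\quad(3,n+2),\quad(3,2n-1)\ \text{(two of them)},\quad(6,2n-2).$$
   Context: $\mathbb K$ is an algebraically closed field, $R=\mathbb K[s,t;u,v]$ is $\mathbb Z^2$-graded with $\deg s=\deg t=(1,0)$, $\deg u=\deg v=(0,1)$. For $W=\operatorname{Span}\{f_0,f_1,f_2\}$, $I_W=\langle f_0,f_1,f_2\rangle$; $W$ is basepoint free if $\sqrt{I_W}=\langle s,t\rangle\cap\langle u,v\rangle$. $\Sigma_{1,n}\subset\mathbb P(R_{(1,n)})$ is the set of polynomials that factor as a product of a form of bidegree $(1,0)$ and one of bidegree $(0,n)$ (the Segre image of $\mathbb P^1\times\mathbb P^n$); $\Sigma'_{3,n-1}\subset\mathbb P(R_{(1,n)})$ is the image of $\mathbb P(R_{(1,1)})\times\mathbb P(R_{(0,n-1)})$ under multiplication. A pencil means that the span of $h_0,h_1,h_2$ has dimension two. The first syzygy module is $\operatorname{Syz}=\ker\big(R(-1,-n)^3\xrightarrow{(f_0,f_1,f_2)}R\big)$;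 a syzygy with entries of bidegree $\mathbf e$ has bidegree $\mathbf e+(1,n)$. "Has minimal first syzygies of the listed bidegrees" means that a minimal bihomogeneous generating set of $\operatorname{Syz}$ contains elements with these bidegrees, counted with the stated multiplicities (added when listed bidegrees coincide). *)

theory Defs
  imports
    "HOL-Analysis.Analysis"
    "HOL-Library.Poly_Mapping"
    "HOL-Library.Multiset"
begin

text \<open>An element of \<open>R = K[s,t;u,v]\<close> is a finitely supported map from exponent vectors to coefficients; the ring
  structure is the convolution product of \<^theory>\<open>HOL-Library.Poly_Mapping\<close>.\<close>

datatype var = Var_s | Var_t | Var_u | Var_v

type_synonym 'k bipoly = "(var \<Rightarrow>\<^sub>0 nat) \<Rightarrow>\<^sub>0 'k"

definition X :: "var \<Rightarrow> 'k::comm_ring_1 bipoly" where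
  "X x = Poly_Mapping.single (Poly_Mapping.single x 1) 1"

definition scale :: "'k::field \<Rightarrow> 'k bipoly \<Rightarrow> 'k bipoly" where
  "scale c p = Poly_Mapping.map ((*) c) p"

lemma lookup_scale: "Poly_Mapping.lookup (scale c p) m = c * Poly_Mapping.lookup p m"
  by (simp add: scale_def Poly_Mapping.map.rep_eq when_def)

interpretation bipoly: vector_space "scale :: 'k::field \<Rightarrow> 'k bipoly \<Rightarrow> 'k bipoly"
  by unfold_locales
    (rule poly_mapping_eqI; simp add: lookup_scale lookup_add algebra_simps)+

text \<open>\<open>bihom i j\<close> is the bigraded piece \<open>R\<^bsub>(i,j)\<^esub>\<close>. The pieces with a negative index vanish,
  so natural numbers suffice as indices.\<close>

definition bihom :: "nat \<Rightarrow> nat \<Rightarrow> 'k::field bipoly set" where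
  "bihom i j = {p. \<forall>m \<in> Poly_Mapping.keys p.
      Poly_Mapping.lookup m Var_s + Poly_Mapping.lookup m Var_t = i \<and>
      Poly_Mapping.lookup m Var_u + Poly_Mapping.lookup m Var_v = j}"


text \<open>A commutative ring as a module over itself: \<open>ideal.span A\<close> is the ideal generated by \<open>A\<close>.\<close>

interpretation ideal: module "(*) :: 'a::comm_ring_1 \<Rightarrow> 'a \<Rightarrow> 'a"
  by unfold_locales (simp_all add: algebra_simps)

definition radical :: "'a::comm_ring_1 set \<Rightarrow> 'a set" where
  "radical I = {p. \<exists>k. p ^ k \<in> I}"

text \<open>For \<open>W = Span {f\<^sub>0, f\<^sub>1, f\<^sub>2}\<close>, the ideal \<open>ideal.span W\<close> is
  \<open>I\<^sub>W = \<langle>f\<^sub>0, f\<^sub>1, f\<^sub>2\<rangle>\<close>.\<close>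

definition basepoint_free :: "'k::field bipoly set \<Rightarrow> bool" where
  "basepoint_free W \<longleftrightarrow>
     radical (ideal.span W) = ideal.span {X Var_s, X Var_t} \<inter> ideal.span {X Var_u, X Var_v}"


text \<open>The points of \<open>P(V)\<close> are the lines through the origin in \<open>V\<close>.\<close>

definition point :: "'k::field bipoly \<Rightarrow> 'k bipoly set" where
  "point p = bipoly.span {p}"

definition proj :: "'k::field bipoly set \<Rightarrow> 'k bipoly set set" where
  "proj V = point ` (V - {0})"

text \<open>A projective line is \<open>P(L)\<close> for a two-dimensional \<open>L\<close>.\<close>

definition collinear_points :: "'k::field bipoly set set \<Rightarrow> bool" where
  "collinear_points A \<longleftrightarrow> (\<exists>L. bipoly.subspace L \<and> bipoly.dim L = 2 \<and> A \<subseteq> proj L)"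

definition mult_image ::
    "'k::field bipoly set \<Rightarrow> 'k bipoly set \<Rightarrow> 'k bipoly set set" where
  "mult_image V V' = {point (p * q) | p q. p \<in> V - {0} \<and> q \<in> V' - {0}}"

definition Sigma_1 :: "nat \<Rightarrow> 'k::field bipoly set set" where
  "Sigma_1 n = mult_image (bihom 1 0) (bihom 0 n)"

definition Sigma_3' :: "nat \<Rightarrow> 'k::field bipoly set set" where
  "Sigma_3' n = mult_image (bihom 1 1) (bihom 0 (n - 1))"


text \<open>The three generators are indexed by the three-element type \<open>3\<close>, with elements
  \<open>0, 1, 2\<close>; the entries of a syzygy form a vector of the free module \<open>R\<^sup>3\<close>.\<close>

interpretation free: module "(*s) :: 'a::comm_ring_1 \<Rightarrow> 'a^'n \<Rightarrow> 'a^'n"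
  by unfold_locales (simp_all add: vec_eq_iff algebra_simps)

definition syz :: "(3 \<Rightarrow> 'k::field bipoly) \<Rightarrow> ('k bipoly^3) set" where
  "syz f = {a. (\<Sum>i\<in>UNIV. a $ i * f i) = 0}"

text \<open>The kernel lives in \<open>R(-1,-n)\<^sup>3\<close>, so entries of bidegree \<open>e\<close> give bidegree \<open>e + (1,n)\<close>.\<close>

definition has_bidegree :: "nat \<Rightarrow> 'k::field bipoly^3 \<Rightarrow> nat \<times> nat \<Rightarrow> bool" where
  "has_bidegree n a d \<longleftrightarrow>
     (\<exists>e\<^sub>1 e\<^sub>2. d = (e\<^sub>1 + 1, e\<^sub>2 + n) \<and> (\<forall>i. a $ i \<in> bihom e\<^sub>1 e\<^sub>2))"

definition minimal_bihom_generators ::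
    "nat \<Rightarrow> (3 \<Rightarrow> 'k::field bipoly) \<Rightarrow> ('k bipoly^3) set \<Rightarrow> bool" where
  "minimal_bihom_generators n f B \<longleftrightarrow>
     (\<forall>b\<in>B. \<exists>d. has_bidegree n b d) \<and>
     free.span B = syz f \<and>
     (\<forall>C. C \<subset> B \<longrightarrow> free.span C \<noteq> syz f)"

text \<open>Some minimal generating set contains elements of the bidegrees in \<open>D\<close>, with at least the
  multiplicities of \<open>D\<close>; by graded Nakayama the number of elements of a given bidegree does not
  depend on the minimal generating set.\<close>

definition has_minimal_first_syzygies ::
    "nat \<Rightarrow> (3 \<Rightarrow> 'k::field bipoly) \<Rightarrow> (nat \<times> nat) multiset \<Rightarrow> bool" where
  "has_minimal_first_syzygies n f D \<longleftrightarrow>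
     (\<exists>B. minimal_bihom_generators n f B \<and>
          (\<forall>d. count D d \<le> card {b \<in> B. has_bidegree n b d}))"

end

theory Submission
  imports Defs
begin

text \<open>Write \<open>f\<^sub>i = g\<^sub>i h\<^sub>i\<close> and \<open>m = n - 1\<close>, and index syzygies by the bidegree \<open>e\<close> of their entries; let \<open>V\<^sub>e\<close> be
  the space of syzygies with entries of bidegree \<open>e\<close> and \<open>M\<^sub>e \<subseteq> V\<^sub>e\<close> the part generated by syzygies of
  smaller bidegree. Some minimal generating set has at least \<open>dim V\<^sub>e - dim M\<^sub>e\<close> elements in each bidegree
  (\<open>minimal_generators_exist\<close>), so it suffices to bound \<open>dim V\<^sub>e\<close> from below and \<open>dim M\<^sub>e\<close> from above.

  The lower bound is a dimension count: \<open>V\<^sub>e\<close> is the kernel of a linear map from three copies of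
  \<open>R\<^sub>e\<close> to the piece of bidegree \<open>e + (1,n)\<close> (\<open>syz_piece_dim_ge\<close>).

  The upper bound needs the syzygies of small bidegree. No two of the \<open>h\<^sub>i\<close> share a root: above such a
  root the remaining \<open>g\<^sub>k\<close>, a linear form in \<open>s,t\<close>, has a zero, which is a base point. Hence every
  coefficient of the linear relation between the \<open>h\<^sub>i\<close> is nonzero, and moving these coefficients from
  \<open>h\<^sub>i\<close> to \<open>g\<^sub>i\<close>, which does not change \<open>f\<^sub>i\<close>, gives \<open>h\<^sub>0 + h\<^sub>1 + h\<^sub>2 = 0\<close>. Then
  \<open>\<sigma> = (g\<^sub>1g\<^sub>2, g\<^sub>0g\<^sub>2, g\<^sub>0g\<^sub>1)\<close> is a syzygy. For any syzygy \<open>q\<close>, comparing with the relation of the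
  \<open>h\<^sub>i\<close> yields one form \<open>z\<close> such that the differences of the \<open>q\<^sub>i g\<^sub>i\<close> are the \<open>z h\<^sub>k\<close>
  (\<open>connecting_form\<close>), and \<open>q\<close> is a multiple of \<open>\<sigma>\<close> exactly if \<open>z = 0\<close>.

  Since \<open>P(W)\<close> misses \<open>\<Sigma>\<^bsub>1,n\<^esub>\<close>, no \<open>g\<^sub>i\<close> has a factor of bidegree \<open>(1,0)\<close>, so the curve \<open>g\<^sub>i = 0\<close> is
  the graph of a map from the \<open>(s:t)\<close>-line to the \<open>(u:v)\<close>-line, and forms on it are binary forms in
  \<open>s,t\<close>. On this curve \<open>z\<close> is divisible by the two coprime quadratic forms cut out by the other two
  \<open>g\<^sub>j\<close>: geometrically, \<open>z\<close> vanishes at the six intersection points of the three curves. For small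
  bidegrees \<open>z\<close> has no room for that, so \<open>z = 0\<close> (\<open>syzygy_multiple_of_\<sigma>\<close>). For entries of bidegree
  \<open>(0,j)\<close> a separate argument applies: such a syzygy is parallel to the cross product of the two
  coefficient vectors of \<open>(f\<^sub>0,f\<^sub>1,f\<^sub>2)\<close> with respect to \<open>s,t\<close>; the entries of the cross product have
  degree \<open>2n\<close> and no common root, so nothing of smaller degree exists (\<open>no_low_syzygy_in_u_v\<close>).

  The resulting bounds for \<open>dim V\<^sub>e\<close> and \<open>dim M\<^sub>e\<close> are \<open>1, 0\<close> for \<open>e = (0,2n)\<close>; \<open>3, 0\<close> for \<open>(1,n)\<close>;
  \<open>1, 0\<close> for \<open>(2,2)\<close>, where \<open>\<sigma>\<close> lives; \<open>n, n-2\<close> for \<open>(2,n-1)\<close>; and \<open>4n-11, 4n-12\<close> for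
  \<open>(5,n-2)\<close>. If \<open>n = 3\<close>, the third and fourth bidegree coincide, \<open>M\<^sub>e\<close> vanishes there, and all three
  generators come from the dimension count.\<close>

section \<open>Polynomials in four variables and substitution\<close>

text \<open>For scalar multiplication by multiplication in the ring, this rule reverses the direction of the
  associative law, and the simplifier does not terminate on products.\<close>

declare ideal.scale_scale [simp del]

text \<open>A linear order of the variables makes \<open>R\<close> an instance of the integral domains.\<close>

instantiation var :: linorder
begin
fun var_rank :: "var \<Rightarrow> nat" where
  "var_rank Var_s = 0" | "var_rank Var_t = 1" | "var_rank Var_u = 2" | "var_rank Var_v = 3"
definition less_eq_var :: "var \<Rightarrow> var \<Rightarrow> bool" where "x \<le> y \<longleftrightarrow> var_rank x \<le> var_rank y"
definition less_var :: "var \<Rightarrow> var \<Rightarrow> bool" where "x < y \<longleftrightarrow> var_rank x < var_rank y"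
instance
proof
  fix x y :: var
  assume "x \<le> y" "y \<le> x"
  then show "x = y" by (cases x; cases y) (simp_all add: less_eq_var_def)
qed (auto simp: less_eq_var_def less_var_def)
end

lemma UNIV_var: "(UNIV :: var set) = {Var_s, Var_t, Var_u, Var_v}"
  using var.exhaust by auto

instance var :: finite
  by standard (simp add: UNIV_var)

definition C :: "'k::comm_ring_1 \<Rightarrow> 'k bipoly" where
  "C c = Poly_Mapping.single 0 c"

lemma C_add: "C (a + b) = C a + C b" by (simp add: C_def single_add)
lemma C_mult: "C (a * b) = C a * C b" by (simp add: C_def mult_single)
lemma C_0 [simp]: "C 0 = 0" by (simp add: C_def)
lemma C_1 [simp]: "C 1 = 1" by (simp add: C_def)
lemma C_minus: "C (- a) = - C a" by (simp add: C_def single_uminus)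
lemma C_eq_iff [simp]: "C a = C b \<longleftrightarrow> a = b"
  by (metis C_def lookup_single_eq)
lemma C_eq_0_iff [simp]: "C a = 0 \<longleftrightarrow> a = 0" using C_eq_iff[of a 0] by simp
lemma scale_eq_C: "scale c p = C c * p"
  by (simp add: scale_def C_def mult_map_scale_conv_mult)

lemma sum_single_keys: "p = (\<Sum>m\<in>Poly_Mapping.keys p. Poly_Mapping.single m (Poly_Mapping.lookup p m))"
  by (rule poly_mapping_eqI)
    (auto simp: lookup_sum lookup_single when_def in_keys_iff sum.If_cases)

lemma bipoly_induct [case_names zero single add]:
  assumes "P 0" and "\<And>m c. P (Poly_Mapping.single m c)" and "\<And>p q. P p \<Longrightarrow> P q \<Longrightarrow> P (p + q)"
  shows "P (p :: 'k::comm_ring_1 bipoly)"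
proof -
  have "P (\<Sum>m\<in>S. Poly_Mapping.single m (Poly_Mapping.lookup p m))" if "finite S" for S
    using that by (induction S) (auto intro: assms)
  then show ?thesis by (subst sum_single_keys) simp
qed

definition monomial_value :: "(var \<Rightarrow> 'a::comm_ring_1) \<Rightarrow> (var \<Rightarrow>\<^sub>0 nat) \<Rightarrow> 'a" where
  "monomial_value \<phi> m = (\<Prod>x\<in>UNIV. \<phi> x ^ Poly_Mapping.lookup m x)"

text \<open>The endomorphism of \<open>R\<close> over the ground field with prescribed values on the variables. Values in
  \<open>R\<close> itself cover evaluation at points (constant values) as well as restriction to a curve.\<close>

definition subst :: "(var \<Rightarrow> 'k::comm_ring_1 bipoly) \<Rightarrow> 'k bipoly \<Rightarrow> 'k bipoly" where
  "subst \<phi> p = (\<Sum>m\<in>Poly_Mapping.keys p. C (Poly_Mapping.lookup p m) * monomial_value \<phi> m)"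

lemma subst_superset:
  assumes "finite S" "Poly_Mapping.keys p \<subseteq> S"
  shows "subst \<phi> p = (\<Sum>m\<in>S. C (Poly_Mapping.lookup p m) * monomial_value \<phi> m)"
  unfolding subst_def using assms by (intro sum.mono_neutral_left) (auto simp: in_keys_iff)

lemma subst_single: "subst \<phi> (Poly_Mapping.single m c) = C c * monomial_value \<phi> m"
  by (subst subst_superset[of "{m}"]) auto

lemma subst_0 [simp]: "subst \<phi> 0 = 0" by (simp add: subst_def)

lemma subst_add [simp]: "subst \<phi> (p + q) = subst \<phi> p + subst \<phi> q"
proof -
  let ?S = "Poly_Mapping.keys p \<union> Poly_Mapping.keys q"
  have "Poly_Mapping.keys (p + q) \<subseteq> ?S" by (rule keys_add)
  then show ?thesis
    by (simp add: subst_superset[of ?S] lookup_add C_add distrib_right sum.distrib)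
qed

lemma monomial_value_add: "monomial_value \<phi> (m + m') = monomial_value \<phi> m * monomial_value \<phi> m'"
  by (simp add: monomial_value_def lookup_add power_add prod.distrib)

lemma subst_mult [simp]: "subst \<phi> (p * q) = subst \<phi> p * subst \<phi> q"
proof (induction p rule: bipoly_induct)
  case (single m c)
  show ?case
  proof (induction q rule: bipoly_induct)
    case (single m' c')
    have "C (c * c') * (monomial_value \<phi> m * monomial_value \<phi> m') =
        (C c * monomial_value \<phi> m) * (C c' * monomial_value \<phi> m')"
      unfolding C_mult by (simp only: mult.assoc mult.left_commute)
    then show ?case by (simp only: mult_single subst_single monomial_value_add)
  next
    case (add p q)
    then show ?case by (simp only: distrib_left subst_add)
  qed simp
next
  case (add p q)
  then show ?case by (simp only: distrib_right subst_add)
qed simp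

lemma subst_C [simp]: "subst \<phi> (C c) = C c"
  by (simp add: C_def[of c] subst_single monomial_value_def)

lemma subst_X [simp]: "subst \<phi> (X x) = \<phi> x"
proof -
  have "monomial_value \<phi> (Poly_Mapping.single x 1) = (\<Prod>y\<in>UNIV. if y = x then \<phi> y else 1)"
    unfolding monomial_value_def
  proof (rule prod.cong)
    fix y
    show "\<phi> y ^ Poly_Mapping.lookup (Poly_Mapping.single x 1) y = (if y = x then \<phi> y else 1)"
      by (cases "y = x") (simp_all add: lookup_single)
  qed simp
  also have "\<dots> = \<phi> x" by (subst prod.delta) simp_all
  finally show ?thesis unfolding X_def subst_single by simp
qed

lemma subst_1 [simp]: "subst \<phi> 1 = 1" using subst_C[of \<phi> 1] by simp
lemma subst_minus [simp]: "subst \<phi> (- p) = - subst \<phi> p"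
  using subst_add[of \<phi> p "- p"] by (simp add: eq_neg_iff_add_eq_0 add.commute)
lemma subst_diff [simp]: "subst \<phi> (p - q) = subst \<phi> p - subst \<phi> q"
  using subst_add[of \<phi> p "- q"] by simp
lemma subst_power [simp]: "subst \<phi> (p ^ k) = subst \<phi> p ^ k"
  by (induction k) simp_all
lemma subst_prod [simp]: "subst \<phi> (prod f S) = (\<Prod>i\<in>S. subst \<phi> (f i))"
  by (induction S rule: infinite_finite_induct) simp_all

lemma subst_subst: "subst \<psi> (subst \<phi> p) = subst (\<lambda>x. subst \<psi> (\<phi> x)) p"
  by (induction p rule: bipoly_induct) (simp_all add: subst_single monomial_value_def)

section \<open>Binary forms: roots, factors, and Euclid's lemma\<close>

text \<open>The pairs \<open>s,t\<close> and \<open>u,v\<close> play symmetric roles. All statements concern binary forms in \<open>x,y\<close>, possibly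
  with coefficients that are forms in \<open>z,w\<close>, and are used for both ways of naming the pairs.\<close>

locale variable_pairs =
  fixes x y z w :: var
  assumes UNIV_eq: "UNIV = {x, y, z, w}" and dist: "distinct [x, y, z, w]"
begin

lemma neqs [simp]: "x \<noteq> y" "x \<noteq> z" "x \<noteq> w" "y \<noteq> x" "y \<noteq> z" "y \<noteq> w"
  "z \<noteq> x" "z \<noteq> y" "z \<noteq> w" "w \<noteq> x" "w \<noteq> y" "w \<noteq> z"
  using dist by auto

definition piece :: "nat \<Rightarrow> nat \<Rightarrow> 'k::field bipoly set" where
  "piece i j = {p. \<forall>m \<in> Poly_Mapping.keys p.
      Poly_Mapping.lookup m x + Poly_Mapping.lookup m y = i \<and>
      Poly_Mapping.lookup m z + Poly_Mapping.lookup m w = j}"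

lemma piece_0 [simp]: "0 \<in> piece i j" by (simp add: piece_def)

lemma piece_add: "p \<in> piece i j \<Longrightarrow> q \<in> piece i j \<Longrightarrow> p + q \<in> piece i j"
  using keys_add[of p q] by (auto simp: piece_def)

lemma piece_uminus: "p \<in> piece i j \<Longrightarrow> - p \<in> piece i j"
  by (auto simp: piece_def in_keys_iff)

lemma piece_diff: "p \<in> piece i j \<Longrightarrow> q \<in> piece i j \<Longrightarrow> p - q \<in> piece i j"
  using piece_add[of p i j "- q"] piece_uminus[of q i j] by simp

lemma piece_sum: "(\<And>k. k \<in> S \<Longrightarrow> f k \<in> piece i j) \<Longrightarrow> sum f S \<in> piece i j"
  by (induction S rule: infinite_finite_induct) (simp_all add: piece_add)

lemma piece_mult: "p \<in> piece i j \<Longrightarrow> q \<in> piece i' j' \<Longrightarrow> p * q \<in> piece (i + i') (j + j')"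
  unfolding piece_def using keys_mult[of p q] by (fastforce simp: lookup_add)

lemma piece_C [simp]: "C c \<in> piece 0 0" by (simp add: piece_def C_def)
lemma piece_1 [simp]: "1 \<in> piece 0 0" using piece_C[of 1] by simp

lemma piece_C_mult: "p \<in> piece i j \<Longrightarrow> C c * p \<in> piece i j"
  using piece_mult[OF piece_C] by force

lemma piece_X:
  "X x \<in> piece 1 0" "X y \<in> piece 1 0" "X z \<in> piece 0 1" "X w \<in> piece 0 1"
  by (simp_all add: piece_def X_def lookup_single when_def)

lemma piece_power: "p \<in> piece i j \<Longrightarrow> p ^ k \<in> piece (k * i) (k * j)"
  by (induction k) (auto intro: piece_mult)

lemma piece_00: "p \<in> piece 0 0 \<Longrightarrow> \<exists>c. p = C c"
proof -
  assume p: "p \<in> piece 0 0"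
  have k0: "m = 0" if "m \<in> Poly_Mapping.keys p" for m
  proof (rule poly_mapping_eqI)
    fix a :: var
    have "a \<in> {x, y, z, w}" using UNIV_eq by blast
    then show "Poly_Mapping.lookup m a = Poly_Mapping.lookup 0 a"
      using p that by (auto simp: piece_def)
  qed
  have "p = C (Poly_Mapping.lookup p 0)"
    by (rule poly_mapping_eqI) (use k0 in \<open>auto simp: C_def lookup_single when_def in_keys_iff\<close>)
  then show ?thesis ..
qed

lemma piece_single:
  "c \<noteq> 0 \<Longrightarrow> Poly_Mapping.single m c \<in> piece i j \<longleftrightarrow> Poly_Mapping.lookup m x + Poly_Mapping.lookup m y = i \<and>
      Poly_Mapping.lookup m z + Poly_Mapping.lookup m w = j"
  by (simp add: piece_def)

lemma piece_induct [consumes 1, case_names zero single add]: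
  assumes p: "p \<in> piece i j" and "P 0"
    and single: "\<And>m c. Poly_Mapping.single m c \<in> piece i j \<Longrightarrow> c \<noteq> 0 \<Longrightarrow> P (Poly_Mapping.single m c)"
    and add: "\<And>p q. P p \<Longrightarrow> P q \<Longrightarrow> P (p + q)"
  shows "P (p :: 'k::field bipoly)"
proof -
  have "P (\<Sum>m\<in>S. Poly_Mapping.single m (Poly_Mapping.lookup p m))"
    if "finite S" "S \<subseteq> Poly_Mapping.keys p" for S
    using that
  proof (induction S)
    case (insert m S)
    have "P (Poly_Mapping.single m (Poly_Mapping.lookup p m))"
      using p insert.prems by (intro single) (auto simp: piece_def in_keys_iff)
    then show ?case using insert by (simp add: add)
  qed (simp add: assms)
  then show ?thesis by (subst sum_single_keys) simp
qed

lemma single_pull: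
  assumes "Poly_Mapping.lookup m a > 0"
  shows "Poly_Mapping.single m c = X a * Poly_Mapping.single (m - Poly_Mapping.single a 1) c"
proof -
  have "m = Poly_Mapping.single a 1 + (m - Poly_Mapping.single a 1)"
    by (rule poly_mapping_eqI) (use assms in \<open>auto simp: lookup_add lookup_minus lookup_single when_def\<close>)
  then show ?thesis by (simp add: X_def mult_single)
qed

text \<open>The basis of all inductions on the degree: every monomial of positive degree in \<open>x,y\<close> is a multiple
  of \<open>x\<close> or of \<open>y\<close>.\<close>

lemma piece_split:
  assumes "p \<in> piece (Suc i) j"
  shows "\<exists>p1 p2. p1 \<in> piece i j \<and> p2 \<in> piece i j \<and> p = X x * p1 + X y * p2"
  using assms
proof (induction p rule: piece_induct)
  case zero
  show ?case by (intro exI[of _ 0]) auto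
next
  case (single m c)
  from single have *: "Poly_Mapping.lookup m x + Poly_Mapping.lookup m y = Suc i"
    "Poly_Mapping.lookup m z + Poly_Mapping.lookup m w = j" by (simp_all add: piece_single)
  show ?case
  proof (cases "Poly_Mapping.lookup m x > 0")
    case True
    then have "Poly_Mapping.single (m - Poly_Mapping.single x 1) c \<in> piece i j"
      using * single by (auto simp: piece_single lookup_minus lookup_single when_def)
    then show ?thesis using single_pull[OF True, of c]
      by (intro exI[of _ "Poly_Mapping.single (m - Poly_Mapping.single x 1) c"] exI[of _ 0]) auto
  next
    case False
    then have y: "Poly_Mapping.lookup m y > 0" using * by simp
    then have "Poly_Mapping.single (m - Poly_Mapping.single y 1) c \<in> piece i j"
      using * single by (auto simp: piece_single lookup_minus lookup_single when_def)
    then show ?thesis using single_pull[OF y, of c]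
      by (intro exI[of _ "Poly_Mapping.single (m - Poly_Mapping.single y 1) c"] exI[of _ 0]) auto
  qed
next
  case (add p q)
  then obtain p1 p2 q1 q2 where "p1 \<in> piece i j" "p2 \<in> piece i j" "p = X x * p1 + X y * p2"
    "q1 \<in> piece i j" "q2 \<in> piece i j" "q = X x * q1 + X y * q2" by blast
  then show ?case
    by (intro exI[of _ "p1 + q1"] exI[of _ "p2 + q2"]) (auto simp: piece_add algebra_simps)
qed

text \<open>Restriction to the fibre over the point \<open>r\<close> of the projective line with coordinates \<open>x,y\<close>; the
  coordinates \<open>z,w\<close> along the fibre survive.\<close>

definition restr :: "'k::field \<times> 'k \<Rightarrow> 'k bipoly \<Rightarrow> 'k bipoly" where
  "restr r = subst (X(x := C (fst r), y := C (snd r)))"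

lemma restr_simps [simp]:
  "restr r (p + q) = restr r p + restr r q" "restr r (p * q) = restr r p * restr r q" "restr r (p - q) = restr r p - restr r q"
  "restr r (- p) = - restr r p" "restr r (p ^ k) = restr r p ^ k" "restr r 0 = 0" "restr r 1 = 1"
  "restr r (C c) = C c" "restr r (X x) = C (fst r)" "restr r (X y) = C (snd r)"
  "restr r (X z) = X z" "restr r (X w) = X w"
  by (simp_all add: restr_def)

text \<open>The linear form with root \<open>r\<close>.\<close>

definition lin :: "'k::field \<times> 'k \<Rightarrow> 'k bipoly" where
  "lin r = C (snd r) * X x - C (fst r) * X y"

lemma lin_piece: "lin r \<in> piece 1 0"
  unfolding lin_def by (intro piece_diff piece_C_mult piece_X)

lemma restr_lin [simp]: "restr r (lin r) = 0"
  by (simp add: lin_def mult.commute)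

lemma subst_fix:
  assumes "p \<in> piece i 0" "\<phi> x = X x" "\<phi> y = X y"
  shows "subst \<phi> p = p"
  using assms(1)
proof (induction i arbitrary: p)
  case 0
  then show ?case using piece_00 by fastforce
next
  case (Suc i)
  then obtain p1 p2 where "p1 \<in> piece i 0" "p2 \<in> piece i 0" "p = X x * p1 + X y * p2"
    using piece_split by blast
  then show ?case using Suc.IH assms by simp
qed

text \<open>Modulo a linear form, both variables are multiples of a single linear form \<open>v\<close>, so a form of degree
  \<open>a\<close> reduces to a multiple of the power \<open>v\<^sup>a\<close>.\<close>

lemma reduce_mod_lin:
  assumes x: "X x = C \<alpha> * lin r + C \<beta> * v" and y: "X y = C \<gamma> * lin r + C \<delta> * v"
    and v: "v \<in> piece 1 0" and "p \<in> piece a b"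
  shows "\<exists>q c. c \<in> piece 0 b \<and> (if a = 0 then q = 0 else q \<in> piece (a - 1) b) \<and>
    p = lin r * q + c * v ^ a"
  using assms(4)
proof (induction a arbitrary: p)
  case 0
  then show ?case by (intro exI[of _ 0] exI[of _ p]) auto
next
  case (Suc a)
  then obtain p1 p2 where p: "p1 \<in> piece a b" "p2 \<in> piece a b" "p = X x * p1 + X y * p2"
    using piece_split by blast
  from Suc.IH[OF p(1)] obtain q1 c1 where 1: "c1 \<in> piece 0 b"
    "if a = 0 then q1 = 0 else q1 \<in> piece (a - 1) b" "p1 = lin r * q1 + c1 * v ^ a" by blast
  from Suc.IH[OF p(2)] obtain q2 c2 where 2: "c2 \<in> piece 0 b"
    "if a = 0 then q2 = 0 else q2 \<in> piece (a - 1) b" "p2 = lin r * q2 + c2 * v ^ a" by blast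
  have q: "X x * q1 + X y * q2 + C \<alpha> * (c1 * v ^ a) + C \<gamma> * (c2 * v ^ a) \<in> piece a b"
  proof -
    have c: "C \<alpha> * (c1 * v ^ a) + C \<gamma> * (c2 * v ^ a) \<in> piece a b"
      using piece_mult[OF 1(1) piece_power[OF v, of a]] piece_mult[OF 2(1) piece_power[OF v, of a]]
      by (intro piece_add piece_C_mult) simp_all
    have "X x * q1 + X y * q2 \<in> piece a b"
    proof (cases a)
      case (Suc a')
      then have "q1 \<in> piece a' b" "q2 \<in> piece a' b" using 1(2) 2(2) by simp_all
      then show ?thesis
        using piece_mult[OF piece_X(1), of q1 a' b] piece_mult[OF piece_X(2), of q2 a' b] Suc
        by (intro piece_add) simp_all
    qed (use 1(2) 2(2) in simp)
    from piece_add[OF this c] show ?thesis by (simp only: add.assoc)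
  qed
  have "p = lin r * (X x * q1 + X y * q2 + C \<alpha> * (c1 * v ^ a) + C \<gamma> * (c2 * v ^ a))
    + (C \<beta> * c1 + C \<delta> * c2) * v ^ Suc a"
  proof -
    have "p = lin r * (X x * q1 + X y * q2) + X x * (c1 * v ^ a) + X y * (c2 * v ^ a)"
      unfolding p(3) 1(3) 2(3) by (simp add: algebra_simps)
    also have "X x * (c1 * v ^ a) = (C \<alpha> * lin r + C \<beta> * v) * (c1 * v ^ a)" by (simp only: x)
    also have "X y * (c2 * v ^ a) = (C \<gamma> * lin r + C \<delta> * v) * (c2 * v ^ a)" by (simp only: y)
    finally show ?thesis by (simp add: algebra_simps)
  qed
  moreover have "C \<beta> * c1 + C \<delta> * c2 \<in> piece 0 b"
    using 1 2 by (intro piece_add piece_C_mult)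
  ultimately show ?case using q by (intro exI conjI) auto
qed

lemma piece_split2:
  fixes p :: "'k::field bipoly"
  assumes "p \<in> piece i (Suc j)"
  shows "\<exists>p1 p2. p1 \<in> piece i j \<and> p2 \<in> piece i j \<and> p = X z * p1 + X w * p2"
proof -
  interpret opp: variable_pairs z w x y by standard (use UNIV_eq in auto)
  have "opp.piece j' i' = (piece i' j' :: 'k bipoly set)" for i' j' by (auto simp: piece_def opp.piece_def)
  then show ?thesis using opp.piece_split[of p j i] assms by simp
qed

lemma restr_coeff: "c \<in> piece 0 b \<Longrightarrow> restr r c = c"
proof (induction b arbitrary: c)
  case 0
  then show ?case using piece_00 by fastforce
next
  case (Suc b)
  then show ?case using piece_split2[of c 0 b] by fastforce
qed

lemma restr_form_const: "p \<in> piece a 0 \<Longrightarrow> \<exists>c. restr r p = C c"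
proof (induction a arbitrary: p)
  case 0
  then show ?case using piece_00 by fastforce
next
  case (Suc a)
  from piece_split[OF Suc.prems] obtain p1 p2 where
    p: "p1 \<in> piece a 0" "p2 \<in> piece a 0" "p = X x * p1 + X y * p2" by blast
  obtain c1 c2 where "restr r p1 = C c1" "restr r p2 = C c2" using Suc.IH p by blast
  then have "restr r p = C (fst r * c1 + snd r * c2)" unfolding p(3) by (simp add: C_add C_mult)
  then show ?case ..
qed

text \<open>The factor theorem. Writing \<open>p\<close> as a multiple of the linear form plus \<open>c v\<^sup>a\<close>, where \<open>v\<close> is whichever
  variable does not vanish at \<open>r\<close>, restriction to the fibre over \<open>r\<close> leaves only \<open>c\<close>.\<close>

lemma lin_divides:
  assumes "p \<in> piece a b" "r \<noteq> (0, 0)" "restr r p = 0"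
  shows "\<exists>q. (if a = 0 then q = 0 else q \<in> piece (a - 1) b) \<and> p = lin r * q"
proof -
  obtain r1 r2 where r: "r = (r1, r2)" by force
  have "\<exists>\<alpha> \<beta> \<gamma> \<delta> v. X x = C \<alpha> * lin r + C \<beta> * v \<and> X y = C \<gamma> * lin r + C \<delta> * v \<and>
      v \<in> piece 1 0 \<and> restr r v \<noteq> 0"
  proof (cases "r2 = 0")
    case False
    have "C (1 / r2) * lin r + C (r1 / r2) * X y = C (1 / r2 * r2) * X x"
      unfolding lin_def r fst_conv snd_conv right_diff_distrib mult.assoc[symmetric] C_mult[symmetric]
      by simp
    then have "X x = C (1 / r2) * lin r + C (r1 / r2) * X y" using False by simp
    moreover have "X y = C 0 * lin r + C 1 * X y" by simp
    moreover have "restr r (X y) \<noteq> 0" using False r by simp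
    ultimately show ?thesis using piece_X(2) by blast
  next
    case True
    then have r1: "r1 \<noteq> 0" using assms r by simp
    have "C (- 1 / r1) * lin r + C 0 * X x = C (1 / r1 * r1) * X y"
      unfolding lin_def r fst_conv snd_conv right_diff_distrib mult.assoc[symmetric] C_mult[symmetric]
      by (simp add: True C_minus)
    then have "X y = C (- 1 / r1) * lin r + C 0 * X x" using r1 by simp
    moreover have "X x = C 0 * lin r + C 1 * X x" by simp
    moreover have "restr r (X x) \<noteq> 0" using r1 r by simp
    ultimately show ?thesis using piece_X(1) by blast
  qed
  then obtain \<alpha> \<beta> \<gamma> \<delta> v where v: "X x = C \<alpha> * lin r + C \<beta> * v" "X y = C \<gamma> * lin r + C \<delta> * v"
      "v \<in> piece 1 0" and nz: "restr r v \<noteq> 0" by blast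
  from reduce_mod_lin[OF v assms(1)] obtain q c where c: "c \<in> piece 0 b"
    "if a = 0 then q = 0 else q \<in> piece (a - 1) b" "p = lin r * q + c * v ^ a" by blast
  then have "c * restr r v ^ a = 0" using assms(3) by (simp add: restr_coeff)
  then have "c = 0" using nz by simp
  then show ?thesis using c by (intro exI[of _ q]) auto
qed

lemma lin_nonzero: "r \<noteq> (0, 0) \<Longrightarrow> lin r \<noteq> 0"
proof
  assume r: "r \<noteq> (0, 0)" "lin r = 0"
  have "restr (1, 0) (lin r) = C (snd r)" "restr (0, 1) (lin r) = - C (fst r)"
    by (simp_all add: lin_def)
  then show False using r by (cases r) auto
qed

lemma dehomogenize:
  assumes "p \<in> piece a 0"
  shows "\<exists>P :: 'k::field poly. degree P \<le> a \<and> (\<forall>r. restr (r, 1) p = C (poly P r)) \<and> restr (1, 0) p = C (coeff P a)"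
  using assms
proof (induction a arbitrary: p)
  case 0
  then obtain c where "p = C c" using piece_00 by blast
  then show ?case by (intro exI[of _ "[:c:]"]) simp
next
  case (Suc a)
  then obtain p1 p2 where p: "p1 \<in> piece a 0" "p2 \<in> piece a 0" "p = X x * p1 + X y * p2"
    using piece_split by blast
  from Suc.IH[OF p(1)] obtain P1 where P1: "degree P1 \<le> a" "\<And>r. restr (r, 1) p1 = C (poly P1 r)"
    "restr (1, 0) p1 = C (coeff P1 a)" by blast
  from Suc.IH[OF p(2)] obtain P2 where P2: "degree P2 \<le> a" "\<And>r. restr (r, 1) p2 = C (poly P2 r)"
    "restr (1, 0) p2 = C (coeff P2 a)" by blast
  have "degree (pCons 0 P1 + P2) \<le> Suc a"
    using P1(1) P2(1) by (intro degree_add_le) auto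
  moreover have "coeff P2 (Suc a) = 0" using P2(1) by (simp add: coeff_eq_0)
  ultimately show ?case using P1 P2
    by (intro exI[of _ "pCons 0 P1 + P2"]) (simp add: p(3) C_add C_mult add.commute)
qed

text \<open>Either the point at infinity \<open>(1,0)\<close> is a root, or the dehomogenized polynomial keeps its full, positive
  degree and has a root in the algebraically closed field.\<close>

lemma root_exists:
  assumes "p \<in> piece (Suc a) 0"
  shows "\<exists>r. r \<noteq> (0, 0) \<and> restr r (p :: 'k::alg_closed_field bipoly) = 0"
proof -
  obtain P where P: "degree P \<le> Suc a" "\<And>r. restr (r, 1) p = C (poly P r)"
    "restr (1, 0) p = C (coeff P (Suc a))" using dehomogenize[OF assms] by blast
  show ?thesis
  proof (cases "coeff P (Suc a) = 0")
    case True
    then show ?thesis using P by (intro exI[of _ "(1, 0)"]) simp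
  next
    case False
    then have "degree P > 0" using le_degree[of P "Suc a"] by simp
    then obtain t where "poly P t = 0" using alg_closed_imp_poly_has_root by blast
    then show ?thesis using P by (intro exI[of _ "(t, 1)"]) simp
  qed
qed

text \<open>Euclid's lemma for binary forms, with several cofactors at once: if \<open>G\<close> divides all \<open>A F\<close> with
  \<open>F \<in> S\<close>, and no root of \<open>G\<close> is common to all of \<open>S\<close>, then \<open>G\<close> divides \<open>A\<close>. The linear factors of \<open>G\<close>
  are cancelled one at a time: a root of \<open>G\<close> is not a root of some \<open>F\<close>, hence it is a root of \<open>A\<close>. The form
  \<open>A\<close> may involve the other two variables; the bound on the degree of the quotient makes \<open>A = 0\<close> when
  \<open>G\<close> has the larger degree.\<close>

lemma coprime_dvd:
  fixes G :: "'k::alg_closed_field bipoly"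
  assumes "G \<in> piece c 0" "A \<in> piece b e" and "\<And>F. F \<in> S \<Longrightarrow> G dvd A * F"
    and "\<And>r. r \<noteq> (0, 0) \<Longrightarrow> restr r G = 0 \<Longrightarrow> \<exists>F\<in>S. restr r F \<noteq> 0"
  shows "\<exists>A'. A = G * A' \<and> (if c \<le> b then A' \<in> piece (b - c) e else A' = 0)"
  using assms
proof (induction c arbitrary: b A G)
  case 0
  from piece_00[OF 0(1)] obtain k where G: "G = C k" by blast
  show ?case
  proof (cases "k = 0")
    case True
    with 0(4)[of "(1, 0)"] G obtain F where "F \<in> S" "restr (1, 0) F \<noteq> 0" by auto
    then have "F \<noteq> 0" by auto
    moreover have "A * F = 0" using 0(3)[OF \<open>F \<in> S\<close>] True G by simp
    ultimately have "A = 0" by simp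
    then show ?thesis by (intro exI[of _ 0]) simp
  next
    case False
    then have "G * C (1 / k) = 1" unfolding G C_mult[symmetric] by simp
    then have "A = G * (C (1 / k) * A)" by (simp only: mult.assoc[symmetric] mult_1_left)
    then show ?thesis using 0(2) by (intro exI[of _ "C (1 / k) * A"]) (simp add: piece_C_mult)
  qed
next
  case (Suc c)
  from root_exists[OF Suc.prems(1)] obtain r where r: "r \<noteq> (0, 0)" "restr r G = 0" by blast
  from lin_divides[OF Suc.prems(1) r] obtain G' where G': "G' \<in> piece c 0" "G = lin r * G'" by auto
  from Suc.prems(4)[OF r] obtain F where F: "F \<in> S" "restr r F \<noteq> 0" by blast
  from Suc.prems(3)[OF F(1)] obtain B where "A * F = G * B" by (auto elim: dvdE)
  then have "restr r A * restr r F = 0" using r(2) by (metis restr_simps(2) mult_zero_left)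
  then have "restr r A = 0" using F by simp
  from lin_divides[OF Suc.prems(2) r(1) this] obtain A1
    where A1: "if b = 0 then A1 = 0 else A1 \<in> piece (b - 1) e" "A = lin r * A1" by blast
  show ?case
  proof (cases b)
    case 0
    then show ?thesis using A1 by (intro exI[of _ 0]) auto
  next
    case (Suc b')
    then have A1': "A1 \<in> piece b' e" using A1 by simp
    have "G' dvd A1 * F'" if "F' \<in> S" for F'
    proof -
      have "lin r * G' dvd lin r * (A1 * F')"
        using Suc.prems(3)[OF that] G' A1 by (simp add: mult.assoc)
      then show ?thesis using lin_nonzero[OF r(1)] by (simp only: dvd_mult_cancel_left) simp
    qed
    moreover have "\<exists>F\<in>S. restr r' F \<noteq> 0" if "r' \<noteq> (0, 0)" "restr r' G' = 0" for r'
      using Suc.prems(4)[OF that(1)] that(2) G'(2) by simp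
    ultimately obtain A' where "A1 = G' * A'" "if c \<le> b' then A' \<in> piece (b' - c) e else A' = 0"
      using Suc.IH[OF G'(1) A1'] by blast
    then show ?thesis using A1(2) G'(2) Suc by (intro exI[of _ A']) (auto simp: mult.assoc)
  qed
qed

end

interpretation st: variable_pairs Var_s Var_t Var_u Var_v
  by standard (simp_all add: UNIV_var)

interpretation uv: variable_pairs Var_u Var_v Var_s Var_t
  by standard (auto simp: UNIV_var)

lemma st_piece [simp]: "st.piece i j = bihom i j"
  by (simp add: st.piece_def bihom_def)

lemma uv_piece [simp]: "uv.piece i j = bihom j i"
  by (auto simp: uv.piece_def bihom_def)

section \<open>Forms on the curves cut out by the first factors\<close>

lemmas bihom_0 [simp] = st.piece_0[unfolded st_piece]
lemmas bihom_add = st.piece_add[unfolded st_piece]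
lemmas bihom_uminus = st.piece_uminus[unfolded st_piece]
lemmas bihom_diff = st.piece_diff[unfolded st_piece]
lemmas bihom_mult = st.piece_mult[unfolded st_piece]
lemmas bihom_C [simp] = st.piece_C[unfolded st_piece]
lemmas bihom_C_mult = st.piece_C_mult[unfolded st_piece]
lemmas bihom_X = st.piece_X[unfolded st_piece]
lemmas bihom_power = st.piece_power[unfolded st_piece]

lemma bihom_mult_eq:
  "p \<in> bihom i j \<Longrightarrow> q \<in> bihom i' j' \<Longrightarrow> a = i + i' \<Longrightarrow> b = j + j' \<Longrightarrow> p * q \<in> bihom a b"
  using bihom_mult by blast

lemma UNIV_3_012: "(UNIV :: 3 set) = {0, 1, 2}"
proof -
  have "(3 :: 3) = 0" by simp
  then show ?thesis using UNIV_3 by auto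
qed

lemma neq_012 [simp]: "(0::3) \<noteq> 1" "(1::3) \<noteq> 0" "(0::3) \<noteq> 2" "(2::3) \<noteq> 0" "(1::3) \<noteq> 2" "(2::3) \<noteq> 1"
  by simp_all

lemma sum_012: "sum f (UNIV :: 3 set) = f 0 + f 1 + f 2"
  unfolding UNIV_3_012 by (simp add: add.assoc)

lemma all_012: "(\<forall>i :: 3. P i) \<longleftrightarrow> P 0 \<and> P 1 \<and> P 2"
proof -
  have "(\<forall>i :: 3. P i) \<longleftrightarrow> (\<forall>i\<in>UNIV. P i)" by simp
  also have "\<dots> \<longleftrightarrow> P 0 \<and> P 1 \<and> P 2" unfolding UNIV_3_012 by blast
  finally show ?thesis .
qed

lemma third_index: "(i :: 3) \<noteq> j \<Longrightarrow> \<exists>k. k \<noteq> i \<and> k \<noteq> j \<and> (\<forall>l. l = i \<or> l = j \<or> l = k)"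
proof -
  have ex: "(\<exists>k. P k) \<longleftrightarrow> P 0 \<or> P 1 \<or> P 2" for P :: "3 \<Rightarrow> bool"
    using all_012[of "\<lambda>k. \<not> P k"] by blast
  have "\<forall>i j :: 3. i \<noteq> j \<longrightarrow> (\<exists>k. k \<noteq> i \<and> k \<noteq> j \<and> (\<forall>l. l = i \<or> l = j \<or> l = k))"
    unfolding all_012 ex by simp
  then show "i \<noteq> j \<Longrightarrow> \<exists>k. k \<noteq> i \<and> k \<noteq> j \<and> (\<forall>l. l = i \<or> l = j \<or> l = k)" by blast
qed

definition at_point :: "'k::field \<times> 'k \<Rightarrow> 'k \<times> 'k \<Rightarrow> 'k bipoly \<Rightarrow> 'k bipoly" where
  "at_point r q = subst (\<lambda>x. case x of Var_s \<Rightarrow> C (fst r) | Var_t \<Rightarrow> C (snd r) | Var_u \<Rightarrow> C (fst q) | Var_v \<Rightarrow> C (snd q))"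

lemma at_point_simps [simp]:
  "at_point r q (a + b) = at_point r q a + at_point r q b" "at_point r q (a * b) = at_point r q a * at_point r q b"
  "at_point r q (a - b) = at_point r q a - at_point r q b" "at_point r q (- a) = - at_point r q a" "at_point r q 0 = 0" "at_point r q 1 = 1"
  "at_point r q (a ^ k) = at_point r q a ^ k" "at_point r q (C c) = C c"
  "at_point r q (X Var_s) = C (fst r)" "at_point r q (X Var_t) = C (snd r)"
  "at_point r q (X Var_u) = C (fst q)" "at_point r q (X Var_v) = C (snd q)"
  by (simp_all add: at_point_def)

lemma at_point_st_restr: "at_point r q (st.restr r p) = at_point r q p"
  unfolding st.restr_def at_point_def subst_subst
  by (rule arg_cong[where f = "\<lambda>\<phi>. subst \<phi> p"]) (auto split: var.split)

lemma at_point_uv_restr: "at_point r q (uv.restr q p) = at_point r q p"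
  unfolding uv.restr_def at_point_def subst_subst
  by (rule arg_cong[where f = "\<lambda>\<phi>. subst \<phi> p"]) (auto split: var.split)

text \<open>Above a common root of two of the \<open>h\<^sub>i\<close>, the third \<open>g\<^sub>k\<close> restricts to a linear form in \<open>s,t\<close>, which has
  a root; there all three products vanish.\<close>

lemma no_common_factor_of_base_point_free:
  fixes g h :: "3 \<Rightarrow> 'k::alg_closed_field bipoly"
  assumes g: "\<And>i. g i \<in> bihom 1 1"
    and base: "\<And>r q. r \<noteq> (0, 0) \<Longrightarrow> q \<noteq> (0, 0) \<Longrightarrow> \<exists>i. at_point r q (g i * h i) \<noteq> 0"
    and "i \<noteq> j" "q \<noteq> (0, 0)" "uv.restr q (h i) = 0"
  shows "uv.restr q (h j) \<noteq> 0"
proof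
  assume hj: "uv.restr q (h j) = 0"
  obtain k where k: "\<And>l. l = i \<or> l = j \<or> l = k" using third_index[OF assms(3)] by blast
  obtain a b where ab: "a \<in> bihom 1 0" "b \<in> bihom 1 0" "g k = X Var_u * a + X Var_v * b"
    using uv.piece_split[unfolded uv_piece, of "g k" 1 0] g by auto
  have "uv.restr q (g k) = C (fst q) * a + C (snd q) * b"
    using uv.restr_coeff[unfolded uv_piece, OF ab(1)] uv.restr_coeff[unfolded uv_piece, OF ab(2)]
    by (simp add: ab(3))
  also have "\<dots> \<in> bihom (Suc 0) 0" using ab by (auto intro!: bihom_add bihom_C_mult)
  finally obtain r where r: "r \<noteq> (0, 0)" "st.restr r (uv.restr q (g k)) = 0"
    using st.root_exists[unfolded st_piece] by blast
  have "at_point r q (g k) = 0" by (metis r(2) at_point_st_restr at_point_uv_restr at_point_simps(5))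
  moreover have "at_point r q (h i) = 0" "at_point r q (h j) = 0" by (metis assms(5) hj at_point_uv_restr at_point_simps(5))+
  moreover obtain l where "at_point r q (g l * h l) \<noteq> 0" using base[OF r(1) assms(4)] by blast
  ultimately show False using k[of l] by auto
qed

text \<open>The situation after normalization: the products \<open>g\<^sub>i h\<^sub>i\<close> with \<open>g\<^sub>i = A\<^sub>i u + B\<^sub>i v\<close>, where the relation
  of the pencil has coefficients \<open>1\<close>. The last assumption says that \<open>g\<^sub>i\<close> has no factor of bidegree
  \<open>(1,0)\<close>; equivalently, the curve \<open>g\<^sub>i = 0\<close> is the graph of \<open>(s:t) \<mapsto> (B\<^sub>i : -A\<^sub>i)\<close>.\<close>

locale curves =
  fixes A B :: "3 \<Rightarrow> 'k::alg_closed_field bipoly" and h :: "3 \<Rightarrow> 'k bipoly" and m :: nat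
  assumes m: "m \<ge> 2"
    and A: "\<And>i. A i \<in> bihom 1 0" and B: "\<And>i. B i \<in> bihom 1 0"
    and h: "\<And>i. h i \<in> bihom 0 m"
    and h_sum: "h 0 + h 1 + h 2 = 0"
    and no_base_point: "\<And>r q. r \<noteq> (0, 0) \<Longrightarrow> q \<noteq> (0, 0) \<Longrightarrow>
      \<exists>i. at_point r q ((A i * X Var_u + B i * X Var_v) * h i) \<noteq> 0"
    and graph: "\<And>r i. r \<noteq> (0, 0) \<Longrightarrow> st.restr r (A i) = 0 \<Longrightarrow> st.restr r (B i) \<noteq> 0"
begin

definition g :: "3 \<Rightarrow> 'k bipoly" where "g i = A i * X Var_u + B i * X Var_v"

text \<open>Restriction to the curve \<open>g\<^sub>i = 0\<close>, parametrized by \<open>(s:t)\<close>.\<close>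

definition curve :: "3 \<Rightarrow> 'k bipoly \<Rightarrow> 'k bipoly" where
  "curve i = subst (X(Var_u := B i, Var_v := - A i))"

lemma curve_simps [simp]:
  "curve i (a + b) = curve i a + curve i b" "curve i (a * b) = curve i a * curve i b"
  "curve i (a - b) = curve i a - curve i b" "curve i (- a) = - curve i a" "curve i 0 = 0"
  "curve i (a ^ k) = curve i a ^ k" "curve i (C c) = C c"
  "curve i (X Var_u) = B i" "curve i (X Var_v) = - A i"
  "curve i (X Var_s) = X Var_s" "curve i (X Var_t) = X Var_t"
  by (simp_all add: curve_def)

lemma g_in: "g i \<in> bihom 1 1"
  unfolding g_def using bihom_mult[OF A bihom_X(3)] bihom_mult[OF B bihom_X(4)]
  by (intro bihom_add) simp_all

lemma curve_fix: "p \<in> bihom a 0 \<Longrightarrow> curve i p = p"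
  unfolding curve_def by (rule st.subst_fix[unfolded st_piece]) auto

lemma curve_g [simp]: "curve i (g i) = 0"
  using curve_fix[OF A, of i] curve_fix[OF B, of i] by (simp add: g_def mult.commute)

lemma curve_in: "p \<in> bihom a b \<Longrightarrow> curve i p \<in> bihom (a + b) 0"
proof (induction b arbitrary: p)
  case 0
  then show ?case by (simp add: curve_fix)
next
  case (Suc b)
  from uv.piece_split[unfolded uv_piece, OF Suc.prems] obtain p1 p2
    where p: "p1 \<in> bihom a b" "p2 \<in> bihom a b" "p = X Var_u * p1 + X Var_v * p2" by blast
  have "B i * curve i p1 \<in> bihom (a + Suc b) 0"
    by (rule bihom_mult_eq[OF B Suc.IH[OF p(1)]]) auto
  moreover have "- A i * curve i p2 \<in> bihom (a + Suc b) 0"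
    by (rule bihom_mult_eq[OF bihom_uminus[OF A] Suc.IH[OF p(2)]]) auto
  ultimately have "B i * curve i p1 + - A i * curve i p2 \<in> bihom (a + Suc b) 0" by (rule bihom_add)
  then show ?case by (simp add: p(3))
qed

lemma curve_point:
  assumes "r \<noteq> (0, 0)"
  shows "\<exists>q. q \<noteq> (0, 0) \<and> (\<forall>p. st.restr r (curve i p) = at_point r q p)"
proof -
  obtain a b where ab: "st.restr r (A i) = C a" "st.restr r (B i) = C b"
    using st.restr_form_const[unfolded st_piece, OF A] st.restr_form_const[unfolded st_piece, OF B] by metis
  have "st.restr r (curve i p) = at_point r (b, - a) p" for p
    unfolding curve_def st.restr_def at_point_def subst_subst
  proof (rule arg_cong[where f = "\<lambda>\<phi>. subst \<phi> p"], rule ext)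
    fix x
    show "subst (X(Var_s := C (fst r), Var_t := C (snd r))) ((X(Var_u := B i, Var_v := - A i)) x) =
      (case x of Var_s \<Rightarrow> C (fst r) | Var_t \<Rightarrow> C (snd r) | Var_u \<Rightarrow> C (fst (b, - a)) | Var_v \<Rightarrow> C (snd (b, - a)))"
      using ab by (cases x) (simp_all add: st.restr_def C_minus)
  qed
  moreover have "(b, - a) \<noteq> (0, 0)" using graph[OF assms, of i] ab by auto
  ultimately show ?thesis by blast
qed

text \<open>A common root on the curve \<open>g\<^sub>i = 0\<close> of the other two products would be a base point.\<close>

lemma curve_no_common_root:
  assumes "r \<noteq> (0, 0)" "j \<noteq> i" "k \<noteq> i" "j \<noteq> k"
    and "st.restr r (curve i (g j)) * st.restr r (curve i (h j)) = 0"
  shows "st.restr r (curve i (g k)) \<noteq> 0" "st.restr r (curve i (h k)) \<noteq> 0"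
proof -
  from curve_point[OF assms(1), of i] obtain q where q: "q \<noteq> (0, 0)" "\<And>p. st.restr r (curve i p) = at_point r q p"
    by blast
  from no_base_point[OF assms(1) q(1)] obtain l where l: "at_point r q (g l * h l) \<noteq> 0"
    unfolding g_def by blast
  have "l \<noteq> i" using l q(2)[of "g i"] by auto
  moreover have "l \<noteq> j" using l assms(5) q(2) by auto
  moreover have "\<forall>l. l = i \<or> l = j \<or> l = k" using third_index[of i j] assms by metis
  ultimately have "l = k" by blast
  then show "st.restr r (curve i (g k)) \<noteq> 0" "st.restr r (curve i (h k)) \<noteq> 0"
    using l q(2) by auto
qed

text \<open>If \<open>g\<^sub>j\<close> vanished on the whole curve \<open>g\<^sub>i = 0\<close>, a point of that curve on \<open>g\<^sub>k = 0\<close> would be a base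
  point. The restriction of \<open>g\<^sub>j\<close> to the curve is, up to sign, the resultant of \<open>g\<^sub>i\<close> and \<open>g\<^sub>j\<close> with respect
  to \<open>u,v\<close>; its roots are the projections of the intersection points of the two curves.\<close>

lemma resultant_nonzero:
  assumes "j \<noteq> i" shows "curve i (g j) \<noteq> 0"
proof
  assume 0: "curve i (g j) = 0"
  obtain k where k: "k \<noteq> i" "k \<noteq> j" using third_index[OF assms] by auto
  have "curve i (g k) \<in> bihom (Suc 1) 0" using curve_in[OF g_in, of i k] by simp
  from st.root_exists[unfolded st_piece, OF this] obtain r
    where r: "r \<noteq> (0, 0)" "st.restr r (curve i (g k)) = 0" by blast
  show False using curve_no_common_root(1)[of r j i k] r 0 assms k by simp
qed

lemma resultant_swap: "curve i (g j) = - curve j (g i)"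
  using curve_fix[OF A] curve_fix[OF B] by (simp add: g_def)

lemma B_nonzero: "B i \<noteq> 0"
proof
  assume 0: "B i = 0"
  obtain r where "r \<noteq> (0, 0)" "st.restr r (A i) = 0"
    using st.root_exists[unfolded st_piece, of "A i" 0] A by auto
  then have "st.restr r (B i) \<noteq> 0" by (rule graph)
  then show False using 0 by simp
qed

text \<open>The ideal of the curve \<open>g\<^sub>i = 0\<close> is generated by \<open>g\<^sub>i\<close>. Induction on the degree in \<open>u,v\<close>: restricted to the
  curve, the coefficient \<open>c\<close> of the highest power of \<open>v\<close> becomes divisible by \<open>B\<^sub>i\<close> after multiplication
  with a power of \<open>A\<^sub>i\<close>; as \<open>A\<^sub>i\<close> and \<open>B\<^sub>i\<close> have no common root, \<open>B\<^sub>i\<close> divides \<open>c\<close>. Subtracting a multiple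
  of \<open>g\<^sub>i\<close> removes this coefficient, and the rest is divisible by \<open>u\<close>.\<close>

lemma divide_by_g:
  assumes "p \<in> bihom a b" "curve i p = 0"
  shows "\<exists>p'. p = g i * p' \<and> (if a = 0 \<or> b = 0 then p' = 0 else p' \<in> bihom (a - 1) (b - 1))"
  using assms
proof (induction b arbitrary: p)
  case 0
  then show ?case using curve_fix by (intro exI[of _ 0]) auto
next
  case (Suc b)
  \<comment> \<open>Reduction modulo \<open>u\<close>, the linear form with root \<open>(0,1)\<close>, isolates the power of \<open>v\<close>.\<close>
  have "X Var_u = C 1 * uv.lin (0, 1) + C 0 * X Var_v" "X Var_v = C 0 * uv.lin (0, 1) + C 1 * (X Var_v :: 'k bipoly)"
    by (simp_all add: uv.lin_def)
  from uv.reduce_mod_lin[OF this, unfolded uv_piece, OF bihom_X(4) Suc.prems(1)] obtain q c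
    where c: "c \<in> bihom a 0" "q \<in> bihom a b" "p = X Var_u * q + c * X Var_v ^ Suc b"
    by (auto simp: uv.lin_def)
  have "B i * curve i q + c * (- A i) ^ Suc b = 0"
    using Suc.prems(2) c(3) curve_fix[OF c(1)] by simp
  then have "c * (- A i) ^ Suc b = B i * (- curve i q)"
    by (simp only: mult_minus_right eq_neg_iff_add_eq_0 add.commute)
  then have dvd: "B i dvd c * (- A i) ^ Suc b" by simp
  have "\<exists>c'. c = B i * c' \<and> (if 1 \<le> a then c' \<in> bihom (a - 1) 0 else c' = 0)"
  proof (rule st.coprime_dvd[unfolded st_piece, OF B c(1), of "{(- A i) ^ Suc b}"])
    show "\<exists>F\<in>{(- A i) ^ Suc b}. st.restr r F \<noteq> 0" if "r \<noteq> (0, 0)" "st.restr r (B i) = 0" for r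
      using graph[OF that(1), of i] that(2) by auto
  qed (use dvd in auto)
  then obtain c' where c': "c = B i * c'" "if 1 \<le> a then c' \<in> bihom (a - 1) 0 else c' = 0" by blast
  \<comment> \<open>The rest after subtracting the multiple \<open>c' v\<^sup>b\<close> of \<open>g\<^sub>i\<close>, divided by \<open>u\<close>.\<close>
  define p'' where "p'' = q - A i * (c' * X Var_v ^ b)"
  have c'v: "if 1 \<le> a then c' * X Var_v ^ b \<in> bihom (a - 1) b else c' = 0"
    using c'(2) bihom_power[OF bihom_X(4), of b] by (auto intro: bihom_mult_eq)
  have p: "p = g i * (c' * X Var_v ^ b) + X Var_u * p''"
    unfolding p''_def c(3) c'(1) g_def by (simp add: algebra_simps)
  have "p'' \<in> bihom a b"
    unfolding p''_def
  proof (intro bihom_diff c)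
    show "A i * (c' * X Var_v ^ b) \<in> bihom a b"
      using c'v by (cases "1 \<le> a") (auto intro: bihom_mult_eq[OF A])
  qed
  moreover have "curve i p'' = 0"
    using Suc.prems(2) B_nonzero[of i] unfolding p by simp
  ultimately obtain w where w: "p'' = g i * w" "if a = 0 \<or> b = 0 then w = 0 else w \<in> bihom (a - 1) (b - 1)"
    using Suc.IH by blast
  have "X Var_u * w \<in> bihom (a - 1) b"
    using w(2) by (cases "a = 0 \<or> b = 0") (auto intro: bihom_mult_eq[OF bihom_X(3)])
  then have "if a = 0 \<or> Suc b = 0 then c' * X Var_v ^ b + X Var_u * w = 0
      else c' * X Var_v ^ b + X Var_u * w \<in> bihom (a - 1) (Suc b - 1)"
    using c'v w(2) by (auto intro: bihom_add)
  moreover have "p = g i * (c' * X Var_v ^ b + X Var_u * w)"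
    unfolding p w(1) by (simp add: algebra_simps)
  ultimately show ?case by blast
qed

lemma h_coprime:
  assumes "i \<noteq> j" "q \<noteq> (0, 0)" "uv.restr q (h i) = 0"
  shows "uv.restr q (h j) \<noteq> 0"
  using no_common_factor_of_base_point_free[of g h, OF g_in _ assms] no_base_point unfolding g_def by blast

lemma h_nonzero: "h i \<noteq> 0"
proof
  assume 0: "h i = 0"
  obtain j where j: "i \<noteq> j" using third_index[of 0 1] by (metis neq_012(1))
  obtain q where "q \<noteq> (0, 0)" "uv.restr q (h j) = 0"
    using uv.root_exists[unfolded uv_piece, of "h j" "m - 1"] h[of j] m by auto
  then show False using h_coprime[OF j, of q] 0 by simp
qed

text \<open>Eliminating \<open>h\<^sub>2\<close> from the syzygy by \<open>h\<^sub>0 + h\<^sub>1 + h\<^sub>2 = 0\<close> leaves a relation between the coprime forms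
  \<open>h\<^sub>0\<close> and \<open>h\<^sub>1\<close>, so its coefficients are multiples of \<open>h\<^sub>1\<close> and \<open>h\<^sub>0\<close> with the same cofactor \<open>z\<close>.\<close>

lemma connecting_form:
  assumes q: "\<And>i. q i \<in> bihom e1 e2" and syz: "(\<Sum>i\<in>UNIV. q i * (g i * h i)) = 0"
  shows "\<exists>z. (if m \<le> e2 + 1 then z \<in> bihom (e1 + 1) (e2 + 1 - m) else z = 0) \<and>
     q 1 * g 1 - q 0 * g 0 = z * h 2 \<and> q 2 * g 2 - q 1 * g 1 = z * h 0 \<and> q 0 * g 0 - q 2 * g 2 = z * h 1"
proof -
  have h2: "h 2 = - h 0 - h 1" using h_sum by (simp add: eq_neg_iff_add_eq_0 algebra_simps)
  have qg: "q i * g i \<in> bihom (e1 + 1) (e2 + 1)" for i by (rule bihom_mult[OF q g_in])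
  have rel: "(q 2 * g 2 - q 1 * g 1) * h 1 = h 0 * (q 0 * g 0 - q 2 * g 2)"
    using syz unfolding sum_012 h2 by (simp add: algebra_simps)
  have "\<exists>z. q 2 * g 2 - q 1 * g 1 = h 0 * z \<and> (if m \<le> e2 + 1 then z \<in> bihom (e1 + 1) (e2 + 1 - m) else z = 0)"
  proof (rule uv.coprime_dvd[unfolded uv_piece, OF h, of _ _ _ "{h 1}"])
    show "q 2 * g 2 - q 1 * g 1 \<in> bihom (e1 + 1) (e2 + 1)" by (intro bihom_diff qg)
    show "\<exists>F\<in>{h 1}. uv.restr r F \<noteq> 0" if "r \<noteq> (0, 0)" "uv.restr r (h 0) = 0" for r
      using h_coprime[of 0 1] that by simp
  qed (use rel in auto)
  then obtain z where z: "q 2 * g 2 - q 1 * g 1 = h 0 * z"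
    "if m \<le> e2 + 1 then z \<in> bihom (e1 + 1) (e2 + 1 - m) else z = 0" by blast
  have "h 0 * (q 0 * g 0 - q 2 * g 2) = h 0 * (z * h 1)"
    using rel unfolding z(1) by (simp only: mult.assoc)
  then have z1: "q 0 * g 0 - q 2 * g 2 = z * h 1" using h_nonzero[of 0] by simp
  have "q 1 * g 1 - q 0 * g 0 = - (q 2 * g 2 - q 1 * g 1) - (q 0 * g 0 - q 2 * g 2)" by simp
  also have "\<dots> = z * h 2" unfolding z(1) z1 h2 by (simp add: algebra_simps)
  finally show ?thesis using z z1 by (auto simp: mult.commute)
qed

lemma resultants_no_common_root:
  assumes "r \<noteq> (0, 0)" "j \<noteq> i" "k \<noteq> i" "j \<noteq> k" "st.restr r (curve i (g j)) = 0"
  shows "st.restr r (curve i (g k)) \<noteq> 0"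
  using curve_no_common_root(1)[OF assms(1-4)] assms(5) by simp

lemma resultant_in: "curve i (g j) \<in> bihom 2 0"
  using curve_in[OF g_in, of i j] by (simp add: numeral_2_eq_2)

text \<open>On the curve \<open>g\<^sub>i = 0\<close> the relation reads \<open>z h\<^sub>k = \<plusminus> q\<^sub>j g\<^sub>j\<close>, and there \<open>h\<^sub>k\<close> and \<open>g\<^sub>j\<close> have no common
  root.\<close>

lemma resultant_dvd:
  assumes "z \<in> bihom a b" "i \<noteq> j" "j \<noteq> k" "i \<noteq> k"
    and "q i * g i - q j * g j = z * h k \<or> q j * g j - q i * g i = z * h k"
  shows "curve i (g j) dvd curve i z"
proof -
  have "curve i (q i * g i - q j * g j) = - (curve i (q j) * curve i (g j))"
    "curve i (q j * g j - q i * g i) = curve i (q j) * curve i (g j)" by simp_all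
  then have "curve i (z * h k) = - (curve i (q j) * curve i (g j)) \<or> curve i (z * h k) = curve i (q j) * curve i (g j)"
    using assms(5) by metis
  then have dvd: "curve i (g j) dvd curve i z * curve i (h k)" by auto
  have "\<exists>A'. curve i z = curve i (g j) * A' \<and> (if 2 \<le> a + b then A' \<in> bihom (a + b - 2) 0 else A' = 0)"
  proof (rule st.coprime_dvd[unfolded st_piece, OF resultant_in curve_in[OF assms(1)], of "{curve i (h k)}"])
    show "\<exists>F\<in>{curve i (h k)}. st.restr r F \<noteq> 0" if "r \<noteq> (0, 0)" "st.restr r (curve i (g j)) = 0" for r
      using curve_no_common_root(2)[OF that(1), of j i k] that(2) assms by simp
  qed (use dvd in auto)
  then show ?thesis by auto
qed

text \<open>The three curves have no common point, so two resultants on the same curve are coprime and their product,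
  of degree four, divides.\<close>

lemma two_resultants:
  assumes "p \<in> bihom a 0" "j \<noteq> i" "k \<noteq> i" "j \<noteq> k" "curve i (g j) dvd p" "curve i (g k) dvd p"
  shows "\<exists>w. p = curve i (g j) * curve i (g k) * w \<and> (if 4 \<le> a then w \<in> bihom (a - 4) 0 else w = 0)"
proof -
  have "\<exists>w. p = curve i (g j) * w \<and> (if 2 \<le> a then w \<in> bihom (a - 2) 0 else w = 0)"
    by (rule st.coprime_dvd[unfolded st_piece, OF resultant_in assms(1), of "{1}"]) (use assms in auto)
  then obtain w where w: "p = curve i (g j) * w" "if 2 \<le> a then w \<in> bihom (a - 2) 0 else w = 0" by blast
  have w_in: "w \<in> bihom (a - 2) 0" using w(2) by (auto split: if_splits)
  have "\<exists>w'. w = curve i (g k) * w' \<and> (if 2 \<le> a - 2 then w' \<in> bihom (a - 2 - 2) 0 else w' = 0)"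
  proof (rule st.coprime_dvd[unfolded st_piece, OF resultant_in w_in, of "{curve i (g j)}"])
    show "\<exists>F\<in>{curve i (g j)}. st.restr r F \<noteq> 0" if "r \<noteq> (0, 0)" "st.restr r (curve i (g k)) = 0" for r
      using resultants_no_common_root[of r k i j] that assms by auto
  qed (use assms w in \<open>auto simp: mult.commute\<close>)
  then obtain w' where w': "w = curve i (g k) * w'" "if 2 \<le> a - 2 then w' \<in> bihom (a - 2 - 2) 0 else w' = 0" by blast
  show ?thesis
    using w(1) w' by (intro exI[of _ w']) (auto simp: mult.assoc split: if_splits)
qed

end

section \<open>Syzygies of small bidegree\<close>

context curves begin

text \<open>The entries of the syzygy that comes from \<open>h\<^sub>0 + h\<^sub>1 + h\<^sub>2 = 0\<close>.\<close>

definition \<sigma> :: "3 \<Rightarrow> 'k bipoly" where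
  "\<sigma> i = (\<Prod>j\<in>UNIV - {i}. g j)"

lemma \<sigma>_simps: "\<sigma> 0 = g 1 * g 2" "\<sigma> 1 = g 0 * g 2" "\<sigma> 2 = g 0 * g 1"
proof -
  have "UNIV - {0} = {1, 2 :: 3}" "UNIV - {1} = {0, 2 :: 3}" "UNIV - {2} = {0, 1 :: 3}"
    unfolding UNIV_3_012 by auto
  then show "\<sigma> 0 = g 1 * g 2" "\<sigma> 1 = g 0 * g 2" "\<sigma> 2 = g 0 * g 1" by (simp_all add: \<sigma>_def)
qed

text \<open>The common value of the \<open>q\<^sub>i g\<^sub>i\<close> vanishes on all three curves. As \<open>g\<^sub>2\<close> does not vanish identically on
  the first two, \<open>q\<^sub>2\<close> is divisible by \<open>g\<^sub>0\<close> and then by \<open>g\<^sub>1\<close>.\<close>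

lemma multiple_of_\<sigma>:
  assumes q: "\<And>i. q i \<in> bihom e1 e2" and eq: "q 0 * g 0 = q 1 * g 1" "q 1 * g 1 = q 2 * g 2"
  shows "\<exists>y. (\<forall>i. q i = y * \<sigma> i) \<and> (if 2 \<le> e1 \<and> 2 \<le> e2 then y \<in> bihom (e1 - 2) (e2 - 2) else y = 0)"
proof -
  have "curve 0 (q 2) * curve 0 (g 2) = curve 0 (q 0 * g 0)" unfolding eq by simp
  then have "curve 0 (q 2) = 0" using resultant_nonzero[of 2 0] by simp
  from divide_by_g[OF q this] obtain q' where q': "q 2 = g 0 * q'"
    "if e1 = 0 \<or> e2 = 0 then q' = 0 else q' \<in> bihom (e1 - 1) (e2 - 1)" by blast
  have q'_in: "q' \<in> bihom (e1 - 1) (e2 - 1)" using q'(2) by (auto split: if_splits)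
  have "curve 1 (g 0) * curve 1 q' * curve 1 (g 2) = curve 1 (q 2 * g 2)" unfolding q'(1) by simp
  also have "\<dots> = curve 1 (q 1 * g 1)" unfolding eq ..
  finally have "curve 1 q' = 0" using resultant_nonzero[of 2 1] resultant_nonzero[of 0 1] by simp
  from divide_by_g[OF q'_in this] obtain y where y: "q' = g 1 * y"
    "if e1 - 1 = 0 \<or> e2 - 1 = 0 then y = 0 else y \<in> bihom (e1 - 1 - 1) (e2 - 1 - 1)" by blast
  have g_nz: "g i \<noteq> 0" for i
    using resultant_nonzero[of i 0] resultant_nonzero[of i 1] by (cases "i = 0") auto
  have q2: "q 2 = y * \<sigma> 2" unfolding q'(1) y(1) \<sigma>_simps by (simp only: mult.commute mult.left_commute mult.assoc)
  have "g 0 * q 0 = g 0 * (y * \<sigma> 0)"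
    using eq unfolding q2 \<sigma>_simps by (simp only: mult.commute mult.left_commute mult.assoc)
  then have q0: "q 0 = y * \<sigma> 0" using g_nz by simp
  have "g 1 * q 1 = g 1 * (y * \<sigma> 1)"
    using eq unfolding q2 \<sigma>_simps by (simp only: mult.commute mult.left_commute mult.assoc)
  then have q1: "q 1 = y * \<sigma> 1" using g_nz by simp
  have "if 2 \<le> e1 \<and> 2 \<le> e2 then y \<in> bihom (e1 - 2) (e2 - 2) else y = 0"
    using y(2) q'(2) y(1) g_nz[of 1]
    by (auto split: if_splits simp: diff_diff_left numeral_2_eq_2 not_less_eq_eq)
  moreover have "\<forall>i. q i = y * \<sigma> i" unfolding all_012 using q0 q1 q2 by blast
  ultimately show ?thesis by blast
qed

lemma all_resultants_dvd:
  fixes q :: "3 \<Rightarrow> 'k bipoly"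
  assumes "z \<in> bihom a b"
    and "q 1 * g 1 - q 0 * g 0 = z * h 2" "q 2 * g 2 - q 1 * g 1 = z * h 0" "q 0 * g 0 - q 2 * g 2 = z * h 1"
    and "i \<noteq> j"
  shows "curve i (g j) dvd curve i z"
proof -
  have "\<forall>i j. i \<noteq> j \<longrightarrow> curve i (g j) dvd curve i z"
    unfolding all_012
    using resultant_dvd[OF assms(1), of 0 1 2 q] resultant_dvd[OF assms(1), of 1 0 2 q]
      resultant_dvd[OF assms(1), of 0 2 1 q] resultant_dvd[OF assms(1), of 2 0 1 q]
      resultant_dvd[OF assms(1), of 1 2 0 q] resultant_dvd[OF assms(1), of 2 1 0 q] assms(2-4)
    by simp
  then show ?thesis using assms(5) by blast
qed

text \<open>The degree of the connecting form \<open>z\<close> is too small for the divisibilities that it satisfies. If its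
  degree in \<open>u,v\<close> is negative, nothing is left to show. If \<open>z\<close> involves only \<open>s,t\<close>, it equals its restriction
  to every curve, so all three resultants divide it, while its degree is at most five. If \<open>z\<close> has
  bidegree \<open>(2,1)\<close>, its restriction to each curve has degree three and is divisible by a form of degree
  four, so \<open>z\<close> vanishes on all three curves; hence \<open>z = g\<^sub>0 z'\<close> with a form \<open>z'\<close> in \<open>s,t\<close>, and restricting
  to the curve \<open>g\<^sub>1 = 0\<close> gives \<open>z' = 0\<close>.\<close>

lemma syzygy_multiple_of_\<sigma>:
  assumes q: "\<And>i. q i \<in> bihom e1 e2" and syz: "(\<Sum>i\<in>UNIV. q i * (g i * h i)) = 0"
    and deg: "e2 + 1 < m \<or> e2 + 1 = m \<and> e1 \<le> 4 \<or> e2 = m \<and> e1 = 1"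
  shows "\<exists>y. (\<forall>i. q i = y * \<sigma> i) \<and> (if 2 \<le> e1 \<and> 2 \<le> e2 then y \<in> bihom (e1 - 2) (e2 - 2) else y = 0)"
proof -
  from connecting_form[OF q syz] obtain z
    where z: "if m \<le> e2 + 1 then z \<in> bihom (e1 + 1) (e2 + 1 - m) else z = 0"
    and rel: "q 1 * g 1 - q 0 * g 0 = z * h 2" "q 2 * g 2 - q 1 * g 1 = z * h 0" "q 0 * g 0 - q 2 * g 2 = z * h 1" by blast
  have z_in: "z \<in> bihom (e1 + 1) (e2 + 1 - m)" using z by (auto split: if_splits)
  note dvd = all_resultants_dvd[OF z_in rel]
  consider "e2 + 1 < m" | "e2 + 1 = m" "e1 \<le> 4" | "e2 = m" "e1 = 1" using deg by blast
  then have "z = 0"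
  proof cases
    case 1
    then show ?thesis using z by simp
  next
    case 2
    then have z_in': "z \<in> bihom (e1 + 1) 0" using z_in by simp
    note fixed = curve_fix[OF z_in']
    have "curve 0 (g 1) dvd z" "curve 0 (g 2) dvd z" "curve 1 (g 2) dvd z"
      using dvd[of 0 1] dvd[of 0 2] dvd[of 1 2] by (simp_all add: fixed)
    from two_resultants[OF z_in' _ _ _ this(1,2)] obtain w where
      w: "z = curve 0 (g 1) * curve 0 (g 2) * w" "if 4 \<le> e1 + 1 then w \<in> bihom (e1 + 1 - 4) 0 else w = 0" by auto
    have w_in: "w \<in> bihom (e1 + 1 - 4) 0" using w(2) by (auto split: if_splits)
    have "\<exists>w'. w = curve 1 (g 2) * w' \<and> (if 2 \<le> e1 + 1 - 4 then w' \<in> bihom (e1 + 1 - 4 - 2) 0 else w' = 0)"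
    proof (rule st.coprime_dvd[unfolded st_piece, OF resultant_in w_in, of "{curve 0 (g 1) * curve 0 (g 2)}"])
      show "\<exists>F\<in>{curve 0 (g 1) * curve 0 (g 2)}. st.restr r F \<noteq> 0"
        if r: "r \<noteq> (0, 0)" "st.restr r (curve 1 (g 2)) = 0" for r
      proof -
        have "st.restr r (curve 1 (g 0)) \<noteq> 0"
          using resultants_no_common_root[of r 2 1 0] r by auto
        moreover have "st.restr r (curve 2 (g 0)) \<noteq> 0"
          using resultants_no_common_root[of r 1 2 0] r by (simp add: resultant_swap[of 2 1])
        ultimately show ?thesis by (simp add: resultant_swap[of 0])
      qed
      show "curve 1 (g 2) dvd w * F" if "F \<in> {curve 0 (g 1) * curve 0 (g 2)}" for F
        using \<open>curve 1 (g 2) dvd z\<close> that unfolding w(1) by (simp add: mult.commute)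
    qed
    then have "w = 0" using 2 by auto
    then show ?thesis using w by simp
  next
    case 3
    then have z_in': "z \<in> bihom 2 1" using z_in by (simp add: numeral_2_eq_2)
    have 0: "curve i z = 0" if "i \<noteq> j" for i j
    proof -
      have deg: "curve i z \<in> bihom 3 0" using curve_in[OF z_in', of i] by simp
      obtain k where k: "k \<noteq> i" "k \<noteq> j" using third_index[OF \<open>i \<noteq> j\<close>] by blast
      then have "\<exists>w. curve i z = curve i (g j) * curve i (g k) * w \<and>
          (if 4 \<le> (3 :: nat) then w \<in> bihom (3 - 4) 0 else w = 0)"
        using that by (intro two_resultants[OF deg] dvd) auto
      then show ?thesis by simp
    qed
    from divide_by_g[OF z_in' 0[of 0 1]] obtain z' where z': "z = g 0 * z'" "z' \<in> bihom 1 0" by auto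
    have "curve 1 (g 0) * z' = 0" using 0[of 1 0] curve_fix[OF z'(2)] unfolding z'(1) by simp
    then show ?thesis using resultant_nonzero[of 0 1] z' by simp
  qed
  then show ?thesis using rel by (intro multiple_of_\<sigma>[OF q]) simp_all
qed

text \<open>With \<open>f\<^sub>i = s a\<^sub>i + t b\<^sub>i\<close>, the vector \<open>q\<close> is orthogonal to \<open>a\<close> and to \<open>b\<close>, hence parallel to their cross
  product \<open>c\<close>, whose entries have degree \<open>2(m+1)\<close>. At a common root of these entries the values of
  \<open>a\<close> and \<open>b\<close> would be linearly dependent, and a dependency \<open>(s,t)\<close> would give a base point. By
  Euclid's lemma each entry of \<open>c\<close> divides the corresponding entry of \<open>q\<close>, which has smaller degree.\<close>

lemma no_low_syzygy_in_u_v: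
  assumes q: "\<And>i. q i \<in> bihom 0 e2" and syz: "(\<Sum>i\<in>UNIV. q i * (g i * h i)) = 0"
    and e2: "e2 < 2 * (m + 1)"
  shows "q i = 0"
proof -
  have gh: "g i * h i \<in> bihom 1 (m + 1)" for i using bihom_mult[OF g_in h, of i i] by simp
  have "\<forall>i. \<exists>a b. a \<in> bihom 0 (m + 1) \<and> b \<in> bihom 0 (m + 1) \<and> g i * h i = X Var_s * a + X Var_t * b"
    using st.piece_split[unfolded st_piece, of "g _ * h _" 0 "m + 1"] gh by simp
  then obtain a b where a: "\<And>i. a i \<in> bihom 0 (m + 1)" and b: "\<And>i. b i \<in> bihom 0 (m + 1)"
    and gh_eq: "\<And>i. g i * h i = X Var_s * a i + X Var_t * b i" by metis
  note fixed = st.restr_coeff[unfolded st_piece, OF q] st.restr_coeff[unfolded st_piece, OF a]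
    st.restr_coeff[unfolded st_piece, OF b]
  have "st.restr (1, 0) (\<Sum>i\<in>UNIV. q i * (g i * h i)) = (\<Sum>i\<in>UNIV. q i * a i)"
    "st.restr (0, 1) (\<Sum>i\<in>UNIV. q i * (g i * h i)) = (\<Sum>i\<in>UNIV. q i * b i)"
    unfolding sum_012 gh_eq by (simp_all add: fixed)
  then have qa: "q 0 * a 0 + q 1 * a 1 + q 2 * a 2 = 0" and qb: "q 0 * b 0 + q 1 * b 1 + q 2 * b 2 = 0"
    unfolding syz sum_012 by simp_all
  define c where "c i j = a i * b j - a j * b i" for i j
  have c_in: "c i j \<in> bihom 0 (2 * (m + 1))" for i j
    unfolding c_def using bihom_mult[OF a b, of i j] bihom_mult[OF a b, of j i]
    by (intro bihom_diff) (simp_all add: mult_2)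
  have 1: "q 0 * c 0 1 = q 2 * c 1 2" "q 0 * c 2 0 = q 1 * c 1 2" "q 1 * c 0 1 = q 2 * c 2 0"
  proof -
    have "q 0 * c 0 1 - q 2 * c 1 2 = (q 0 * a 0 + q 1 * a 1 + q 2 * a 2) * b 1 - (q 0 * b 0 + q 1 * b 1 + q 2 * b 2) * a 1"
      "q 0 * c 2 0 - q 1 * c 1 2 = (q 0 * b 0 + q 1 * b 1 + q 2 * b 2) * a 2 - (q 0 * a 0 + q 1 * a 1 + q 2 * a 2) * b 2"
      "q 1 * c 0 1 - q 2 * c 2 0 = (q 0 * b 0 + q 1 * b 1 + q 2 * b 2) * a 0 - (q 0 * a 0 + q 1 * a 1 + q 2 * a 2) * b 0"
      unfolding c_def by (simp_all add: algebra_simps)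
    then show "q 0 * c 0 1 = q 2 * c 1 2" "q 0 * c 2 0 = q 1 * c 1 2" "q 1 * c 0 1 = q 2 * c 2 0"
      unfolding qa qb by simp_all
  qed
  have c_root: "\<exists>F\<in>{c 0 1, c 1 2, c 2 0}. uv.restr r F \<noteq> 0" if r: "r \<noteq> (0, 0)" for r
  proof (rule ccontr)
    assume "\<not> ?thesis"
    then have c0: "uv.restr r (c 0 1) = 0" "uv.restr r (c 1 2) = 0" "uv.restr r (c 2 0) = 0" by auto
    obtain \<alpha> \<beta> where \<alpha>: "\<And>i. uv.restr r (a i) = C (\<alpha> i)"
      and \<beta>: "\<And>i. uv.restr r (b i) = C (\<beta> i)"
      using uv.restr_form_const[unfolded uv_piece, OF a] uv.restr_form_const[unfolded uv_piece, OF b] by metis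
    have prop01: "\<alpha> 0 * \<beta> 1 = \<alpha> 1 * \<beta> 0" "\<alpha> 1 * \<beta> 2 = \<alpha> 2 * \<beta> 1" "\<alpha> 2 * \<beta> 0 = \<alpha> 0 * \<beta> 2"
      using c0 unfolding c_def by (simp_all add: \<alpha> \<beta> C_mult[symmetric])
    have sym: "\<forall>i j. \<alpha> i * \<beta> j = \<alpha> j * \<beta> i"
      unfolding all_012 using prop01 by simp
    obtain \<rho> where \<rho>: "\<rho> \<noteq> (0, 0)" "\<And>j. fst \<rho> * \<alpha> j + snd \<rho> * \<beta> j = 0"
    proof (cases "\<forall>i. \<alpha> i = 0 \<and> \<beta> i = 0")
      case True
      then show ?thesis using that[of "(1, 0)"] by simp
    next
      case False
      then obtain i where "\<alpha> i \<noteq> 0 \<or> \<beta> i \<noteq> 0" by blast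
      \<comment> \<open>All vectors \<open>(\<alpha> j, \<beta> j)\<close> are proportional to the nonzero one with index \<open>i\<close>.\<close>
      then show ?thesis using that[of "(- \<beta> i, \<alpha> i)"] sym by (auto simp: mult.commute)
    qed
    obtain j where "at_point \<rho> r (g j * h j) \<noteq> 0"
      using no_base_point[OF \<rho>(1) r] unfolding g_def by blast
    moreover have "at_point \<rho> r (a j) = C (\<alpha> j)" "at_point \<rho> r (b j) = C (\<beta> j)"
      by (metis at_point_uv_restr \<alpha> \<beta> at_point_simps(8))+
    then have "at_point \<rho> r (g j * h j) = C (fst \<rho> * \<alpha> j + snd \<rho> * \<beta> j)"
      unfolding gh_eq by (simp add: C_add C_mult)
    ultimately show False using \<rho>(2) by simp
  qed
  have vanish: "p = 0" if p: "p \<in> bihom 0 e2" and d: "d \<in> bihom 0 (2 * (m + 1))"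
    "d dvd p * c 0 1" "d dvd p * c 1 2" "d dvd p * c 2 0" for p d
  proof -
    have "\<exists>A'. p = d * A' \<and> (if 2 * (m + 1) \<le> e2 then A' \<in> bihom 0 (e2 - 2 * (m + 1)) else A' = 0)"
      by (rule uv.coprime_dvd[unfolded uv_piece, OF d(1) p, of "{c 0 1, c 1 2, c 2 0}"])
        (use d(2-) c_root in auto)
    then show ?thesis using e2 by auto
  qed
  have "q 0 = 0"
    using 1(1,2) by (intro vanish[OF q c_in[of 1 2]]) auto
  moreover have "q 1 = 0"
    using 1(3) 1(2)[symmetric] by (intro vanish[OF q c_in[of 2 0]]) auto
  moreover have "q 2 = 0"
    using 1(1,3)[symmetric] by (intro vanish[OF q c_in[of 0 1]]) auto
  ultimately have "\<forall>i. q i = 0" unfolding all_012 by blast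
  then show ?thesis by blast
qed

end

section \<open>Dimension counts for graded pieces\<close>

text \<open>Rank-nullity without finite-dimensional ambient spaces: a basis of the kernel together with lifts of a
  basis of the image spans the given independent set.\<close>

lemma (in Vector_Spaces.linear) kernel_independent:
  assumes Bs: "finite Bs" "vs1.independent Bs"
    and U: "vs1.subspace U" "Bs \<subseteq> U" and D: "finite D" "f ` U \<subseteq> vs2.span D"
  shows "\<exists>K \<subseteq> {x \<in> U. f x = 0}. finite K \<and> vs1.independent K \<and> card Bs \<le> card K + card D"
proof -
  let ?S = "vs1.span Bs"
  have S_U: "?S \<subseteq> U" by (rule vs1.span_minimal[OF U(2,1)])
  obtain K where K: "K \<subseteq> {x \<in> ?S. f x = 0}" "vs1.independent K" "{x \<in> ?S. f x = 0} \<subseteq> vs1.span K"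
    using vs1.maximal_independent_subset by blast
  have finK: "finite K" using vs1.independent_span_bound[OF Bs(1) K(2)] K(1) by auto
  obtain N where N: "N \<subseteq> f ` ?S" "vs2.independent N" "f ` ?S \<subseteq> vs2.span N"
    using vs2.maximal_independent_subset by blast
  have "N \<subseteq> vs2.span D" using N(1) D(2) S_U by blast
  from vs2.independent_span_bound[OF D(1) N(2) this] have finN: "finite N" "card N \<le> card D" by auto
  \<comment> \<open>Lifts of a basis of the image.\<close>
  define L where "L = inv_into ?S f ` N"
  have L: "finite L" "card L \<le> card D" "L \<subseteq> ?S"
    using finN card_image_le[OF finN(1), of "inv_into ?S f"] N(1)
    by (auto simp: L_def intro: inv_into_into)
  have fL: "f ` L = N" unfolding L_def using N(1) by (force simp: image_image f_inv_into_f)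
  have "?S \<subseteq> vs1.span (K \<union> L)"
  proof
    fix x assume x: "x \<in> ?S"
    then have "f x \<in> f ` vs1.span L" using N(3) unfolding fL[symmetric] span_image by auto
    then obtain l where l: "l \<in> vs1.span L" "f x = f l" by auto
    have "l \<in> ?S" using l(1) vs1.span_minimal[OF L(3) vs1.subspace_span] by blast
    then have "x - l \<in> {x \<in> ?S. f x = 0}" using x l(2) by (simp add: vs1.span_diff diff)
    then have "x - l \<in> vs1.span (K \<union> L)" using K(3) vs1.span_mono[of K "K \<union> L"] by blast
    moreover have "l \<in> vs1.span (K \<union> L)" using l(1) vs1.span_mono[of L "K \<union> L"] by blast
    ultimately have "(x - l) + l \<in> vs1.span (K \<union> L)" by (rule vs1.span_add)
    then show "x \<in> vs1.span (K \<union> L)" by simp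
  qed
  then have "Bs \<subseteq> vs1.span (K \<union> L)" using vs1.span_superset by blast
  then have "card Bs \<le> card (K \<union> L)"
    using vs1.independent_span_bound[OF _ Bs(2)] finK L(1) by blast
  also have "\<dots> \<le> card K + card D" using card_Un_le[of K L] L(2) by simp
  finally show ?thesis using K finK S_U by blast
qed

definition exponents :: "nat \<Rightarrow> nat \<Rightarrow> (var \<Rightarrow>\<^sub>0 nat) set" where
  "exponents i j = {m. Poly_Mapping.lookup m Var_s + Poly_Mapping.lookup m Var_t = i \<and>
      Poly_Mapping.lookup m Var_u + Poly_Mapping.lookup m Var_v = j}"

lemma exponents: "finite (exponents i j)" "card (exponents i j) = (i + 1) * (j + 1)"
proof -
  define e :: "nat \<times> nat \<Rightarrow> var \<Rightarrow>\<^sub>0 nat" where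
    "e = (\<lambda>(a, b). Poly_Mapping.single Var_s a + Poly_Mapping.single Var_t (i - a) +
      Poly_Mapping.single Var_u b + Poly_Mapping.single Var_v (j - b))"
  have e: "Poly_Mapping.lookup (e (a, b)) Var_s = a" "Poly_Mapping.lookup (e (a, b)) Var_t = i - a"
    "Poly_Mapping.lookup (e (a, b)) Var_u = b" "Poly_Mapping.lookup (e (a, b)) Var_v = j - b" for a b
    by (simp_all add: e_def lookup_add lookup_single)
  have "exponents i j = e ` ({..i} \<times> {..j})"
  proof (intro equalityI subsetI)
    fix m assume m: "m \<in> exponents i j"
    have "m = e (Poly_Mapping.lookup m Var_s, Poly_Mapping.lookup m Var_u)"
    proof (rule poly_mapping_eqI)
      fix x show "Poly_Mapping.lookup m x = Poly_Mapping.lookup (e (Poly_Mapping.lookup m Var_s, Poly_Mapping.lookup m Var_u)) x"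
        using m by (cases x) (auto simp: e exponents_def)
    qed
    then show "m \<in> e ` ({..i} \<times> {..j})" using m by (auto simp: exponents_def)
  qed (auto simp: exponents_def e)
  moreover have "inj_on e ({..i} \<times> {..j})" by (auto intro!: inj_onI) (metis e)+
  ultimately show "finite (exponents i j)" "card (exponents i j) = (i + 1) * (j + 1)"
    by (simp_all add: card_image)
qed

lemma keys_exponents: "p \<in> bihom i j \<longleftrightarrow> Poly_Mapping.keys p \<subseteq> exponents i j"
  by (auto simp: bihom_def exponents_def)

lemma bihom_spanned: "\<exists>D. finite D \<and> card D \<le> (i + 1) * (j + 1) \<and> (bihom i j :: 'k::field bipoly set) \<subseteq> bipoly.span D"
proof -
  let ?D = "(\<lambda>m. Poly_Mapping.single m (1 :: 'k)) ` exponents i j"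
  have "p \<in> bipoly.span ?D" if p: "p \<in> bihom i j" for p :: "'k bipoly"
  proof -
    have "(\<Sum>m\<in>Poly_Mapping.keys p. scale (Poly_Mapping.lookup p m) (Poly_Mapping.single m 1)) \<in> bipoly.span ?D"
      using p by (intro bipoly.span_sum bipoly.span_scale bipoly.span_base) (auto simp: keys_exponents)
    moreover have "scale c (Poly_Mapping.single m 1) = Poly_Mapping.single m c" for c :: 'k and m
      by (simp add: scale_eq_C C_def mult_single)
    ultimately show ?thesis by (subst sum_single_keys) simp
  qed
  moreover have "card ?D \<le> (i + 1) * (j + 1)"
    using card_image_le[OF exponents(1)[of i j], of "\<lambda>m. Poly_Mapping.single m (1 :: 'k)"]
    by (simp only: exponents(2))
  ultimately show ?thesis using exponents(1) by (intro exI[of _ ?D]) blast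
qed

definition vscale :: "'k::field \<Rightarrow> 'k bipoly ^ 'n \<Rightarrow> 'k bipoly ^ 'n" where
  "vscale c a = C c *s a"

lemma vscale_nth [simp]: "vscale c a $ i = C c * a $ i"
  by (simp add: vscale_def)

interpretation bivec: vector_space "vscale :: 'k::field \<Rightarrow> 'k bipoly ^ 'n \<Rightarrow> 'k bipoly ^ 'n"
  by unfold_locales (simp_all add: vec_eq_iff C_add C_mult algebra_simps)

definition vec_bihom :: "nat \<Rightarrow> nat \<Rightarrow> ('k::field bipoly ^ 'n) set" where
  "vec_bihom i j = {a. \<forall>k. a $ k \<in> bihom i j}"

lemma vec_bihom_subspace: "bivec.subspace (vec_bihom i j)"
  by (auto simp: bivec.subspace_def vec_bihom_def bihom_add bihom_C_mult)

definition vec_monomial :: "'n \<times> (var \<Rightarrow>\<^sub>0 nat) \<Rightarrow> 'k::field bipoly ^ 'n" where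
  "vec_monomial km = (\<chi> l. if l = fst km then Poly_Mapping.single (snd km) 1 else 0)"

lemma lookup_vec_monomial:
  "Poly_Mapping.lookup ((vec_monomial km :: 'k::field bipoly ^ 'n) $ l) m' = (if (l, m') = km then 1 else 0)"
  by (cases km) (auto simp: vec_monomial_def lookup_single when_def)

lemma vec_monomial_basis:
  fixes i j :: nat
  defines "Bs \<equiv> (vec_monomial ` (UNIV \<times> exponents i j) :: ('k::field bipoly ^ 'n::finite) set)"
  shows "finite Bs" "card Bs = CARD('n) * ((i + 1) * (j + 1))" "bivec.independent Bs"
    "Bs \<subseteq> vec_bihom i j" "vec_bihom i j \<subseteq> bivec.span Bs"
proof -
  let ?b = "vec_monomial :: 'n \<times> (var \<Rightarrow>\<^sub>0 nat) \<Rightarrow> 'k bipoly ^ 'n"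
  have inj: "inj ?b"
  proof (rule injI)
    fix x y assume "?b x = ?b y"
    then show "x = y" using lookup_vec_monomial[of x "fst x" "snd x", where ?'k = 'k] lookup_vec_monomial[of y "fst x" "snd x", where ?'k = 'k]
      by (auto split: if_splits)
  qed
  show fin: "finite Bs" by (simp add: Bs_def exponents)
  show "card Bs = CARD('n) * ((i + 1) * (j + 1))"
    unfolding Bs_def by (subst card_image) (auto simp: card_cartesian_product exponents intro: inj_on_subset[OF inj])
  show "bivec.independent Bs"
  proof (rule bivec.independent_if_scalars_zero[OF fin])
    fix f and x assume sum: "(\<Sum>x\<in>Bs. vscale (f x) x) = 0" and "x \<in> Bs"
    then obtain k m where x: "x = ?b (k, m)" by (auto simp: Bs_def)
    have "0 = Poly_Mapping.lookup ((\<Sum>x\<in>Bs. vscale (f x) x) $ k) m" by (simp add: sum)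
    also have "\<dots> = (\<Sum>y\<in>Bs. f y * Poly_Mapping.lookup (y $ k) m)"
      by (simp add: lookup_sum scale_eq_C[symmetric] lookup_scale)
    also have "\<dots> = (\<Sum>y\<in>Bs. if y = x then f y else 0)"
    proof (rule sum.cong)
      fix y assume "y \<in> Bs"
      then obtain km where y: "y = ?b km" by (auto simp: Bs_def)
      have "y = x \<longleftrightarrow> (k, m) = km" unfolding x y using inj by (auto dest: injD)
      then show "f y * Poly_Mapping.lookup (y $ k) m = (if y = x then f y else 0)"
        by (simp add: y lookup_vec_monomial)
    qed simp
    also have "\<dots> = f x" using \<open>x \<in> Bs\<close> fin by simp
    finally show "f x = 0" by simp
  qed
  show "Bs \<subseteq> vec_bihom i j"
    by (auto simp: Bs_def vec_bihom_def keys_exponents vec_monomial_def split: if_splits)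
  show "vec_bihom i j \<subseteq> bivec.span Bs"
  proof
    fix a :: "'k bipoly ^ 'n" assume a: "a \<in> vec_bihom i j"
    have "a = (\<Sum>k\<in>UNIV. \<Sum>m\<in>Poly_Mapping.keys (a $ k). vscale (Poly_Mapping.lookup (a $ k) m) (?b (k, m)))"
      (is "a = ?r")
    proof (rule vec_eq_iff[THEN iffD2], intro allI)
      fix l
      have "?r $ l = (\<Sum>k\<in>UNIV. if k = l then \<Sum>m\<in>Poly_Mapping.keys (a $ k). Poly_Mapping.single m (Poly_Mapping.lookup (a $ k) m) else 0)"
        unfolding sum_component by (intro sum.cong refl) (auto simp: vec_monomial_def C_def mult_single)
      also have "\<dots> = a $ l" using sum_single_keys[of "a $ l"] by simp
      finally show "a $ l = ?r $ l" by simp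
    qed
    also have "\<dots> \<in> bivec.span Bs"
      using a by (intro bivec.span_sum bivec.span_scale bivec.span_base) (auto simp: Bs_def vec_bihom_def keys_exponents)
    finally show "a \<in> bivec.span Bs" .
  qed
qed

definition syz_piece :: "(3 \<Rightarrow> 'k::field bipoly) \<Rightarrow> nat \<Rightarrow> nat \<Rightarrow> ('k bipoly ^ 3) set" where
  "syz_piece f i j = syz f \<inter> vec_bihom i j"

lemma syz_subspace: "free.subspace (syz f)"
  by (auto simp: free.subspace_def syz_def sum.distrib distrib_right sum_distrib_left[symmetric] mult.assoc)

lemma syz_piece_subspace: "bivec.subspace (syz_piece f i j)"
  unfolding syz_piece_def
  using vec_bihom_subspace syz_subspace[of f]
  by (auto simp: bivec.subspace_def free.subspace_def vscale_def)

lemma syz_piece_dim_ge: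
  fixes f :: "3 \<Rightarrow> 'k::field bipoly"
  assumes f: "\<And>i. f i \<in> bihom a b"
  shows "\<exists>K \<subseteq> syz_piece f i j. finite K \<and> bivec.independent K \<and>
    3 * ((i + 1) * (j + 1)) \<le> card K + (i + a + 1) * (j + b + 1)"
proof -
  define T where "T x = (\<Sum>k\<in>UNIV. x $ k * f k)" for x :: "'k bipoly ^ 3"
  interpret T: Vector_Spaces.linear vscale scale T
    by unfold_locales (simp_all add: T_def scale_eq_C distrib_right sum.distrib sum_distrib_left mult.assoc)
  obtain D where D: "finite D" "card D \<le> (i + a + 1) * (j + b + 1)" "(bihom (i + a) (j + b) :: 'k bipoly set) \<subseteq> bipoly.span D"
    using bihom_spanned[where ?'k = 'k] by metis
  have "T ` vec_bihom i j \<subseteq> bihom (i + a) (j + b)"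
    unfolding T_def vec_bihom_def by (auto intro!: st.piece_sum[unfolded st_piece] bihom_mult f)
  then have "T ` vec_bihom i j \<subseteq> bipoly.span D" using D by blast
  from T.kernel_independent[OF vec_monomial_basis(1,3) vec_bihom_subspace vec_monomial_basis(4) D(1) this]
  obtain K where "K \<subseteq> {x \<in> vec_bihom i j. T x = 0}" "finite K" "bivec.independent K"
    "card (vec_monomial ` (UNIV \<times> exponents i j) :: ('k bipoly ^ 3) set) \<le> card K + card D" by blast
  then show ?thesis using D(2)
    by (intro exI[of _ K]) (auto simp: syz_piece_def syz_def T_def vec_monomial_basis(2))
qed

section \<open>Minimal bihomogeneous generators\<close>

definition homog_part :: "nat \<Rightarrow> nat \<Rightarrow> 'k::field bipoly \<Rightarrow> 'k bipoly" where
  "homog_part i j p = (\<Sum>m\<in>Poly_Mapping.keys p \<inter> exponents i j. Poly_Mapping.single m (Poly_Mapping.lookup p m))"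

lemma lookup_homog_part: "Poly_Mapping.lookup (homog_part i j p) m = (if m \<in> exponents i j then Poly_Mapping.lookup p m else 0)"
  by (auto simp: homog_part_def lookup_sum lookup_single when_def in_keys_iff)

lemma homog_part_add: "homog_part i j (p + q) = homog_part i j p + homog_part i j q"
  by (rule poly_mapping_eqI) (simp add: lookup_homog_part lookup_add)
lemma homog_part_0 [simp]: "homog_part i j 0 = 0" by (simp add: homog_part_def)
lemma homog_part_sum: "homog_part i j (sum f S) = (\<Sum>k\<in>S. homog_part i j (f k))"
  by (induction S rule: infinite_finite_induct) (simp_all add: homog_part_add)
lemma homog_part_in: "homog_part i j p \<in> bihom i j"
  by (auto simp: keys_exponents in_keys_iff lookup_homog_part split: if_splits)
lemma homog_part_bihom: "p \<in> bihom i' j' \<Longrightarrow> homog_part i j p = (if i' = i \<and> j' = j then p else 0)"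
  by (rule poly_mapping_eqI) (force simp: keys_exponents lookup_homog_part in_keys_iff exponents_def subset_iff)

definition bideg :: "(var \<Rightarrow>\<^sub>0 nat) \<Rightarrow> nat \<times> nat" where
  "bideg m = (Poly_Mapping.lookup m Var_s + Poly_Mapping.lookup m Var_t, Poly_Mapping.lookup m Var_u + Poly_Mapping.lookup m Var_v)"

lemma exponents_bideg: "m \<in> exponents i j \<longleftrightarrow> bideg m = (i, j)"
  by (simp add: exponents_def bideg_def)

lemma sum_homog_part:
  assumes "finite E" "\<And>m. m \<in> Poly_Mapping.keys p \<Longrightarrow>
bideg m \<in> E"
  shows "p = (\<Sum>(i, j)\<in>E. homog_part i j p)"
proof (rule poly_mapping_eqI)
  fix m :: "var \<Rightarrow>\<^sub>0 nat"
  have "Poly_Mapping.lookup (\<Sum>(i, j)\<in>E. homog_part i j p) m = (\<Sum>e\<in>E. if e = bideg m then Poly_Mapping.lookup p m else 0)"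
    unfolding lookup_sum by (intro sum.cong) (auto simp: lookup_homog_part exponents_bideg case_prod_beta)
  also have "\<dots> = Poly_Mapping.lookup p m"
    using assms by (auto simp: in_keys_iff)
  finally show "Poly_Mapping.lookup p m = Poly_Mapping.lookup (\<Sum>(i, j)\<in>E. homog_part i j p) m" by simp
qed

lemma homog_part_mult:
  assumes q: "q \<in> bihom a b"
  shows "homog_part i j (p * q) = (if a \<le> i \<and> b \<le> j then homog_part (i - a) (j - b) p * q else 0)"
proof -
  define E where "E = bideg ` Poly_Mapping.keys p"
  have E: "finite E" "p = (\<Sum>(i, j)\<in>E. homog_part i j p)"
    using sum_homog_part[of E p] by (simp_all add: E_def)
  have "homog_part i j (p * q) = homog_part i j (\<Sum>(k, l)\<in>E. homog_part k l p * q)"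
    by (subst (1) E(2)) (simp add: sum_distrib_right case_prod_beta)
  also have "\<dots> = (\<Sum>(k, l)\<in>E. homog_part i j (homog_part k l p * q))" by (simp add: homog_part_sum case_prod_beta)
  also have "\<dots> = (\<Sum>(k, l)\<in>E. if k + a = i \<and> l + b = j then homog_part k l p * q else 0)"
    using homog_part_bihom[OF bihom_mult[OF homog_part_in q]] by (intro sum.cong) auto
  also have "\<dots> = (\<Sum>e\<in>E. if e = (i - a, j - b) then if a \<le> i \<and> b \<le> j then homog_part (i - a) (j - b) p * q else 0 else 0)"
    by (intro sum.cong) (auto split: if_splits)
  also have "\<dots> = (if a \<le> i \<and> b \<le> j then homog_part (i - a) (j - b) p * q else 0)"
  proof (cases "(i - a, j - b) \<in> E")
    case False
    have "homog_part (i - a) (j - b) p = 0"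
      by (rule poly_mapping_eqI) (use False in \<open>auto simp: lookup_homog_part exponents_bideg E_def image_iff not_in_keys_iff_lookup_eq_zero[symmetric]\<close>)
    then show ?thesis using E(1) False by simp
  qed (use E(1) in simp)
  finally show ?thesis .
qed

definition vec_homog_part :: "nat \<Rightarrow> nat \<Rightarrow> 'k::field bipoly ^ 'n \<Rightarrow> 'k bipoly ^ 'n" where
  "vec_homog_part i j a = (\<chi> k. homog_part i j (a $ k))"

lemma vec_homog_part_nth [simp]: "vec_homog_part i j a $ k = homog_part i j (a $ k)" by (simp add: vec_homog_part_def)
lemma vec_homog_part_0 [simp]: "vec_homog_part i j 0 = 0" by (simp add: vec_eq_iff)
lemma vec_homog_part_add: "vec_homog_part i j (a + b) = vec_homog_part i j a + vec_homog_part i j b" by (simp add: vec_eq_iff homog_part_add)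
lemma vec_homog_part_scale:
  "a \<in> vec_bihom k l \<Longrightarrow> vec_homog_part i j (p *s a) = (if k \<le> i \<and> l \<le> j then homog_part (i - k) (j - l) p *s a else 0)"
  using homog_part_mult[of "a $ _" k l i j p] by (auto simp: vec_eq_iff vec_bihom_def)
lemma vec_homog_part_bihom: "a \<in> vec_bihom k l \<Longrightarrow> vec_homog_part i j a = (if k = i \<and> l = j then a else 0)"
  using homog_part_bihom[of "a $ _" k l i j] by (auto simp: vec_eq_iff vec_bihom_def)

lemma vec_homog_part_syz:
  fixes f :: "3 \<Rightarrow> 'k::field bipoly"
  assumes f: "\<And>k. f k \<in> bihom a b" and x: "x \<in> syz f"
  shows "vec_homog_part i j x \<in> syz_piece f i j"
proof -
  have "(\<Sum>k\<in>UNIV. homog_part i j (x $ k) * f k) = homog_part (i + a) (j + b) (\<Sum>k\<in>UNIV. x $ k * f k)"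
    unfolding homog_part_sum using homog_part_mult[OF f] by simp
  also have "\<dots> = 0" using x by (simp add: syz_def)
  finally show ?thesis by (simp add: syz_piece_def syz_def vec_bihom_def homog_part_in)
qed

lemma vec_sum_homog_part: "\<exists>E. finite E \<and> (a :: 'k::field bipoly ^ 'n::finite) = (\<Sum>(i, j)\<in>E. vec_homog_part i j a)"
proof -
  define E where "E = (\<Union>k. bideg ` Poly_Mapping.keys (a $ k))"
  have fin: "finite E" by (simp add: E_def)
  have "a $ k = (\<Sum>(i, j)\<in>E. homog_part i j (a $ k))" for k
    by (rule sum_homog_part[OF fin]) (auto simp: E_def)
  then have "a = (\<Sum>(i, j)\<in>E. vec_homog_part i j a)" by (simp add: vec_eq_iff case_prod_beta)
  then show ?thesis using fin by blast
qed

text \<open>The part of a graded piece of the syzygy module that is generated in smaller bidegrees.\<close>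

definition decomposable :: "(3 \<Rightarrow> 'k::field bipoly) \<Rightarrow> nat \<Rightarrow> nat \<Rightarrow> ('k bipoly ^ 3) set" where
  "decomposable f i j = bivec.span
     ({X x *s a | x a. x \<in> {Var_s, Var_t} \<and> 0 < i \<and> a \<in> syz_piece f (i - 1) j} \<union>
      {X x *s a | x a. x \<in> {Var_u, Var_v} \<and> 0 < j \<and> a \<in> syz_piece f i (j - 1)})"

lemma scale_syz_piece:
  assumes "p \<in> bihom k l" "a \<in> syz_piece f i j"
  shows "p *s a \<in> syz_piece f (i + k) (j + l)"
  using assms syz_subspace[of f]
  by (auto simp: syz_piece_def vec_bihom_def free.subspace_def intro: bihom_mult_eq)

lemma decomposable_subset: "decomposable f i j \<subseteq> syz_piece f i j"
  unfolding decomposable_def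
proof (rule bivec.span_minimal[OF _ syz_piece_subspace])
  have "X x *s a \<in> syz_piece f i j" if "x \<in> {Var_s, Var_t}" "0 < i" "a \<in> syz_piece f (i - 1) j" for x a
    using scale_syz_piece[of "X x" 1 0 a f "i - 1" j] that bihom_X by auto
  moreover have "X x *s a \<in> syz_piece f i j" if "x \<in> {Var_u, Var_v}" "0 < j" "a \<in> syz_piece f i (j - 1)" for x a
    using scale_syz_piece[of "X x" 0 1 a f i "j - 1"] that bihom_X by auto
  ultimately show "{X x *s a | x a. x \<in> {Var_s, Var_t} \<and> 0 < i \<and> a \<in> syz_piece f (i - 1) j} \<union>
      {X x *s a | x a. x \<in> {Var_u, Var_v} \<and> 0 < j \<and> a \<in> syz_piece f i (j - 1)} \<subseteq> syz_piece f i j"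
    by blast
qed

lemma decomposable_mult:
  assumes p: "p \<in> bihom k l" and kl: "k \<noteq> 0 \<or> l \<noteq> 0" and a: "a \<in> syz_piece f i j"
  shows "p *s a \<in> decomposable f (i + k) (j + l)"
proof (cases k)
  case (Suc k')
  with p obtain p1 p2 where p': "p1 \<in> bihom k' l" "p2 \<in> bihom k' l" "p = X Var_s * p1 + X Var_t * p2"
    using st.piece_split[unfolded st_piece] by blast
  have "X Var_s *s (p1 *s a) \<in> decomposable f (i + k) (j + l)" "X Var_t *s (p2 *s a) \<in> decomposable f (i + k) (j + l)"
    using scale_syz_piece[OF p'(1) a] scale_syz_piece[OF p'(2) a] Suc
    unfolding decomposable_def by (intro bivec.span_base; force)+
  then have "X Var_s *s (p1 *s a) + X Var_t *s (p2 *s a) \<in> decomposable f (i + k) (j + l)"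
    unfolding decomposable_def by (rule bivec.span_add)
  then show ?thesis unfolding p'(3) by (simp add: vec_eq_iff algebra_simps)
next
  case 0
  then obtain l' where l: "l = Suc l'" using kl by (cases l) auto
  with p obtain p1 p2 where p': "p1 \<in> bihom k l'" "p2 \<in> bihom k l'" "p = X Var_u * p1 + X Var_v * p2"
    using uv.piece_split[unfolded uv_piece] by blast
  have "X Var_u *s (p1 *s a) \<in> decomposable f (i + k) (j + l)" "X Var_v *s (p2 *s a) \<in> decomposable f (i + k) (j + l)"
    using scale_syz_piece[OF p'(1) a] scale_syz_piece[OF p'(2) a] l
    unfolding decomposable_def by (intro bivec.span_base; force)+
  then have "X Var_u *s (p1 *s a) + X Var_v *s (p2 *s a) \<in> decomposable f (i + k) (j + l)"
    unfolding decomposable_def by (rule bivec.span_add)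
  then show ?thesis unfolding p'(3) by (simp add: vec_eq_iff algebra_simps)
qed

lemma free_span_bivec: "bivec.subspace (free.span B)"
  by (auto simp: bivec.subspace_def vscale_def free.span_add free.span_scale free.span_zero)

lemma has_bidegree_iff: "has_bidegree n b (i + 1, j + n) \<longleftrightarrow> b \<in> vec_bihom i j"
  by (auto simp: has_bidegree_def vec_bihom_def)

text \<open>In each bidegree, choose a complement \<open>G\<close> of the decomposable part inside the graded piece, with a basis
  \<open>N\<close> of the decomposable part (the graded Nakayama lemma). Induction on the bidegree shows that the union
  of all \<open>G\<close> generates. It is minimal: if \<open>b\<close> were generated by other elements, its part of the same
  bidegree would be a linear combination of \<open>N\<close> and the remaining elements of \<open>G\<close>, against independence.
  The stated inequality expresses that the number of generators in a bidegree is at least the dimension of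
  the graded piece minus the dimension of its decomposable part, by means of an independent set \<open>K\<close> in the
  former and a spanning set \<open>D\<close> of the latter.\<close>

theorem minimal_generators_exist:
  fixes f :: "3 \<Rightarrow> 'k::field bipoly"
  assumes f: "\<And>k. f k \<in> bihom 1 n"
  shows "\<exists>B. minimal_bihom_generators n f B \<and>
    (\<forall>i j K D. K \<subseteq> syz_piece f i j \<longrightarrow> bivec.independent K \<longrightarrow> finite D \<longrightarrow> decomposable f i j \<subseteq> bivec.span D \<longrightarrow>
       card K \<le> card {b \<in> B. has_bidegree n b (i + 1, j + n)} + card D)"
proof -
  have "\<exists>N G. N \<subseteq> decomposable f i j \<and> decomposable f i j \<subseteq> bivec.span N \<and> bivec.independent (N \<union> G) \<and>
      N \<inter> G = {} \<and> G \<subseteq> syz_piece f i j \<and> syz_piece f i j \<subseteq> bivec.span (N \<union> G)" for i j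
  proof -
    obtain N where N: "N \<subseteq> decomposable f i j" "bivec.independent N" "decomposable f i j \<subseteq> bivec.span N"
      using bivec.maximal_independent_subset by blast
    then have "N \<subseteq> syz_piece f i j" using decomposable_subset by blast
    from bivec.maximal_independent_subset_extend[OF this N(2)] obtain M
      where M: "N \<subseteq> M" "M \<subseteq> syz_piece f i j" "bivec.independent M" "syz_piece f i j \<subseteq> bivec.span M" by blast
    then have "N \<union> (M - N) = M" by blast
    then show ?thesis using M N by (intro exI[of _ N] exI[of _ "M - N"]) auto
  qed
  then obtain N G where NG: "\<And>i j. N i j \<subseteq> decomposable f i j" "\<And>i j. decomposable f i j \<subseteq> bivec.span (N i j)"
    "\<And>i j. bivec.independent (N i j \<union> G i j)" "\<And>i j. N i j \<inter> G i j = {}" "\<And>i j. G i j \<subseteq> syz_piece f i j"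
    "\<And>i j. syz_piece f i j \<subseteq> bivec.span (N i j \<union> G i j)" by metis
  define B where "B = (\<Union>i j. G i j)"
  have G_nz: "b \<noteq> 0" if "b \<in> G i j" for b i j
    using that NG(3)[of i j] bivec.dependent_zero by blast
  have G_deg: "i = i' \<and> j = j'" if "b \<in> G i j" "b \<in> vec_bihom i' j'" for b i j i' j'
  proof -
    have "b \<in> vec_bihom i j" using NG(5)[of i j] that(1) by (auto simp: syz_piece_def)
    then show ?thesis using vec_homog_part_bihom[of b i j i j] vec_homog_part_bihom[OF that(2), of i j] G_nz[OF that(1)]
      by (auto split: if_splits)
  qed
  have piece: "{b \<in> B. has_bidegree n b (i + 1, j + n)} = G i j" for i j
  proof (intro equalityI subsetI)
    fix b assume "b \<in> {b \<in> B. has_bidegree n b (i + 1, j + n)}"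
    then obtain k l where "b \<in> G k l" "b \<in> vec_bihom i j" unfolding B_def has_bidegree_iff by blast
    then show "b \<in> G i j" using G_deg by blast
  next
    fix b assume "b \<in> G i j"
    then show "b \<in> {b \<in> B. has_bidegree n b (i + 1, j + n)}"
      using NG(5)[of i j] unfolding has_bidegree_iff by (auto simp: B_def syz_piece_def)
  qed
  have span1: "syz_piece f i j \<subseteq> free.span B" for i j
  proof (induction "i + j" arbitrary: i j rule: less_induct)
    case less
    have "decomposable f i j \<subseteq> free.span B"
      unfolding decomposable_def
    proof (rule bivec.span_minimal[OF _ free_span_bivec])
      show "{X x *s a | x a. x \<in> {Var_s, Var_t} \<and> 0 < i \<and> a \<in> syz_piece f (i - 1) j} \<union>
        {X x *s a | x a. x \<in> {Var_u, Var_v} \<and> 0 < j \<and> a \<in> syz_piece f i (j - 1)} \<subseteq> free.span B"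
        using less[of "i - 1" j] less[of i "j - 1"] by (auto intro!: free.span_scale)
    qed
    moreover have "G i j \<subseteq> B" by (auto simp: B_def)
    ultimately have "N i j \<union> G i j \<subseteq> free.span B"
      using NG(1)[of i j] free.span_superset[of B] by blast
    then have "bivec.span (N i j \<union> G i j) \<subseteq> free.span B"
      by (rule bivec.span_minimal[OF _ free_span_bivec])
    then show ?case using NG(6) by blast
  qed
  have "free.span B = syz f"
  proof
    show "free.span B \<subseteq> syz f"
      using NG(5) by (intro free.span_minimal[OF _ syz_subspace]) (auto simp: B_def syz_piece_def)
    show "syz f \<subseteq> free.span B"
    proof
      fix a assume a: "a \<in> syz f"
      obtain E where E: "finite E" "a = (\<Sum>(i, j)\<in>E. vec_homog_part i j a)" using vec_sum_homog_part by blast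
      have "(\<Sum>(i, j)\<in>E. vec_homog_part i j a) \<in> free.span B"
        using vec_homog_part_syz[OF f a] span1 by (intro free.span_sum) (clarsimp, blast)
      then show "a \<in> free.span B" using E(2) by simp
    qed
  qed
  moreover have "free.span S \<noteq> syz f" if "S \<subset> B" for S
  proof
    assume S: "free.span S = syz f"
    obtain b where b: "b \<in> B" "b \<notin> S" using \<open>S \<subset> B\<close> by blast
    then obtain i j where ij: "b \<in> G i j" by (auto simp: B_def)
    let ?T = "bivec.span (N i j \<union> (G i j - {b}))"
    have "vec_homog_part i j x \<in> ?T" if "x \<in> free.span S" for x
      using that
    proof (induction rule: free.span_induct_alt)
      case base
      show ?case by (simp add: bivec.span_zero)
    next
      case (step c x y)
      then have "x \<in> B" using \<open>S \<subset> B\<close> by blast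
      then obtain k l where kl: "x \<in> G k l" by (auto simp: B_def)
      then have x: "x \<in> syz_piece f k l" using NG(5) by blast
      then have homog_part: "vec_homog_part i j (c *s x) = (if k \<le> i \<and> l \<le> j then homog_part (i - k) (j - l) c *s x else 0)"
        by (intro vec_homog_part_scale) (simp add: syz_piece_def)
      have "vec_homog_part i j (c *s x) \<in> ?T"
      proof (cases "k \<le> i \<and> l \<le> j")
        case True
        show ?thesis
        proof (cases "k = i \<and> l = j")
          case eq: True
          then obtain d where "homog_part (i - k) (j - l) c = C d"
            using st.piece_00[unfolded st_piece, of "homog_part 0 0 c"] homog_part_in[of 0 0 c] by auto
          then have "vec_homog_part i j (c *s x) = vscale d x" using homog_part True by (simp add: vscale_def)
          moreover have "x \<in> G i j - {b}" using kl eq step b(2) by auto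
          ultimately show ?thesis by (metis UnCI bivec.span_scale bivec.span_base)
        next
          case False
          then have "homog_part (i - k) (j - l) c *s x \<in> decomposable f (k + (i - k)) (l + (j - l))"
            using True by (intro decomposable_mult[OF homog_part_in _ x]) auto
          then have "vec_homog_part i j (c *s x) \<in> bivec.span (N i j)" using homog_part True NG(2)[of i j] by auto
          then show ?thesis using bivec.span_mono[of "N i j" "N i j \<union> (G i j - {b})"] by blast
        qed
      next
        case False
        then have "vec_homog_part i j (c *s x) = 0" using homog_part by auto
        then show ?thesis by (simp add: bivec.span_zero)
      qed
      then show ?case using step by (simp add: vec_homog_part_add bivec.span_add)
    qed
    moreover have "b \<in> free.span S" using S NG(5)[of i j] ij by (auto simp: syz_piece_def)
    moreover have "vec_homog_part i j b = b" using NG(5)[of i j] ij vec_homog_part_bihom[of b i j i j] by (auto simp: syz_piece_def)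
    ultimately have "b \<in> ?T" by metis
    moreover have "N i j \<union> (G i j - {b}) = (N i j \<union> G i j) - {b}" using NG(4)[of i j] ij by blast
    ultimately have "bivec.dependent (N i j \<union> G i j)"
      using ij by (auto simp: bivec.dependent_def)
    then show False using NG(3) by blast
  qed
  moreover have "\<exists>d. has_bidegree n b d" if "b \<in> B" for b
  proof -
    obtain i j where "b \<in> G i j" using \<open>b \<in> B\<close> by (auto simp: B_def)
    then have "has_bidegree n b (i + 1, j + n)" using piece[of i j] by blast
    then show ?thesis ..
  qed
  ultimately have "minimal_bihom_generators n f B" by (simp add: minimal_bihom_generators_def)
  moreover have "card K \<le> card {b \<in> B. has_bidegree n b (i + 1, j + n)} + card D"
    if K: "K \<subseteq> syz_piece f i j" "bivec.independent K" and D: "finite D" "decomposable f i j \<subseteq> bivec.span D" for i j K D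
  proof -
    have "N i j \<subseteq> bivec.span D" using NG(1) D by blast
    moreover have "bivec.independent (N i j)" using NG(3)[of i j] bivec.independent_mono by blast
    ultimately have N: "finite (N i j)" "card (N i j) \<le> card D" using bivec.independent_span_bound[OF D(1)] by auto
    have "N i j \<union> G i j \<subseteq> vec_bihom i j" using NG(1,5)[of i j] decomposable_subset[of f i j] by (auto simp: syz_piece_def)
    then have "N i j \<union> G i j \<subseteq> bivec.span (vec_monomial ` (UNIV \<times> exponents i j))" using vec_monomial_basis(5) by blast
    from bivec.independent_span_bound[OF vec_monomial_basis(1) NG(3) this] have fin: "finite (N i j \<union> G i j)" by blast
    have "K \<subseteq> bivec.span (N i j \<union> G i j)" using K(1) NG(6) by blast
    from bivec.independent_span_bound[OF fin K(2) this] have "card K \<le> card (N i j \<union> G i j)" by blast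
    also have "\<dots> \<le> card (N i j) + card (G i j)" by (rule card_Un_le)
    finally show ?thesis unfolding piece using N(2) by simp
  qed
  ultimately show ?thesis by blast
qed

section \<open>Counting the minimal syzygies\<close>

context curves begin

abbreviation "f \<equiv> \<lambda>i. g i * h i"

definition \<sigma>v :: "'k bipoly ^ 3" where "\<sigma>v = (\<chi> i. \<sigma> i)"

lemma f_in: "f i \<in> bihom 1 (m + 1)"
  by (rule bihom_mult_eq[OF g_in h]) auto

lemma syz_piece_multiple:
  assumes x: "x \<in> syz_piece f i j" and deg: "j + 1 < m \<or> j + 1 = m \<and> i \<le> 4 \<or> j = m \<and> i = 1 \<or> i = 0 \<and> j < 2 * (m + 1)"
  shows "\<exists>y. x = y *s \<sigma>v \<and> (if 2 \<le> i \<and> 2 \<le> j then y \<in> bihom (i - 2) (j - 2) else y = 0)"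
proof (cases "i = 0 \<and> j < 2 * (m + 1)")
  case True
  then have "x $ k = 0" for k
    using x no_low_syzygy_in_u_v[of "\<lambda>k. x $ k" j k] by (simp add: syz_piece_def syz_def vec_bihom_def)
  then show ?thesis using True by (intro exI[of _ 0]) (simp add: vec_eq_iff)
next
  case False
  then have "\<exists>y. (\<forall>k. x $ k = y * \<sigma> k) \<and> (if 2 \<le> i \<and> 2 \<le> j then y \<in> bihom (i - 2) (j - 2) else y = 0)"
    using x deg by (intro syzygy_multiple_of_\<sigma>) (auto simp: syz_piece_def syz_def vec_bihom_def)
  then show ?thesis by (auto simp: vec_eq_iff \<sigma>v_def)
qed

lemma \<sigma>v_in: "\<sigma>v \<in> syz_piece f 2 2"
proof -
  have "\<forall>i. \<sigma> i \<in> bihom 2 2"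
    unfolding all_012 \<sigma>_simps using bihom_mult[OF g_in g_in] by (simp add: numeral_2_eq_2)
  moreover have "(\<Sum>i\<in>UNIV. \<sigma> i * f i) = g 0 * g 1 * g 2 * (h 0 + h 1 + h 2)"
    unfolding sum_012 \<sigma>_simps by (simp add: algebra_simps)
  ultimately show ?thesis by (simp add: syz_piece_def syz_def vec_bihom_def \<sigma>v_def h_sum)
qed

lemma \<sigma>v_nonzero: "\<sigma>v \<noteq> 0"
proof
  assume "\<sigma>v = 0"
  then have "\<sigma> 0 = 0" by (simp add: \<sigma>v_def vec_eq_iff)
  then have "g 1 = 0 \<or> g 2 = 0" by (simp add: \<sigma>_simps)
  then show False using resultant_nonzero[of 1 0] resultant_nonzero[of 2 0] by auto
qed

text \<open>The two assumptions put the two neighbouring smaller bidegrees into the range where all syzygies are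
  multiples \<open>y \<sigma>\<close>. The decomposable part then consists of such multiples with \<open>y\<close> of bidegree
  \<open>(i-2,j-2)\<close>. In bidegree \<open>(2,2)\<close> it vanishes, although \<open>\<sigma>\<close> itself has this bidegree, as both
  neighbours are zero.\<close>

lemma decomposable_dim_le:
  assumes 1: "0 < i \<Longrightarrow> j + 1 < m \<or> j + 1 = m \<and> i - 1 \<le> 4 \<or> j = m \<and> i - 1 = 1 \<or> i - 1 = 0 \<and> j < 2 * (m + 1)"
    and 2: "0 < j \<Longrightarrow> j < m \<or> j = m \<and> i \<le> 4 \<or> j = m + 1 \<and> i = 1 \<or> i = 0 \<and> j \<le> 2 * (m + 1)"
  shows "\<exists>D. finite D \<and> decomposable f i j \<subseteq> bivec.span D \<and>
    card D \<le> (if 2 \<le> i \<and> 2 \<le> j \<and> (i, j) \<noteq> (2, 2) then (i - 1) * (j - 1) else 0)"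
proof -
  let ?gens = "{X x *s a | x a. x \<in> {Var_s, Var_t} \<and> 0 < i \<and> a \<in> syz_piece f (i - 1) j} \<union>
      {X x *s a | x a. x \<in> {Var_u, Var_v} \<and> 0 < j \<and> a \<in> syz_piece f i (j - 1)}"
  have gens: "\<exists>y. b = y *s \<sigma>v \<and> (if 2 \<le> i \<and> 2 \<le> j \<and> (i, j) \<noteq> (2, 2) then y \<in> bihom (i - 2) (j - 2) else y = 0)"
    if "b \<in> ?gens" for b
    using that
  proof
    assume "b \<in> {X x *s a | x a. x \<in> {Var_s, Var_t} \<and> 0 < i \<and> a \<in> syz_piece f (i - 1) j}"
    then obtain x a where b: "b = X x *s a" "x \<in> {Var_s, Var_t}" "0 < i" "a \<in> syz_piece f (i - 1) j" by blast
    obtain y where y: "a = y *s \<sigma>v" "if 2 \<le> i - 1 \<and> 2 \<le> j then y \<in> bihom (i - 1 - 2) (j - 2) else y = 0"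
      using syz_piece_multiple[OF b(4) 1[OF b(3)]] by blast
    have "X x * y \<in> bihom (i - 2) (j - 2)"
      using y(2) b(2) bihom_X by (cases "2 \<le> i - 1 \<and> 2 \<le> j") (auto intro!: bihom_mult_eq[where i = 1 and j = 0])
    then show ?thesis using y b(1,3) by (intro exI[of _ "X x * y"]) (auto simp: vec_eq_iff mult.assoc)
  next
    assume "b \<in> {X x *s a | x a. x \<in> {Var_u, Var_v} \<and> 0 < j \<and> a \<in> syz_piece f i (j - 1)}"
    then obtain x a where b: "b = X x *s a" "x \<in> {Var_u, Var_v}" "0 < j" "a \<in> syz_piece f i (j - 1)" by blast
    have "j - 1 + 1 < m \<or> j - 1 + 1 = m \<and> i \<le> 4 \<or> j - 1 = m \<and> i = 1 \<or> i = 0 \<and> j - 1 < 2 * (m + 1)"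
      using 2[OF b(3)] b(3) by auto
    from syz_piece_multiple[OF b(4) this]
    obtain y where y: "a = y *s \<sigma>v" "if 2 \<le> i \<and> 2 \<le> j - 1 then y \<in> bihom (i - 2) (j - 1 - 2) else y = 0" by blast
    have "X x * y \<in> bihom (i - 2) (j - 2)"
      using y(2) b(2) bihom_X by (cases "2 \<le> i \<and> 2 \<le> j - 1") (auto intro!: bihom_mult_eq[where i = 0 and j = 1])
    then show ?thesis using y b(1,3) by (intro exI[of _ "X x * y"]) (auto simp: vec_eq_iff mult.assoc)
  qed
  show ?thesis
  proof (cases "2 \<le> i \<and> 2 \<le> j \<and> (i, j) \<noteq> (2, 2)")
    case True
    obtain D where D: "finite D" "card D \<le> (i - 2 + 1) * (j - 2 + 1)" "(bihom (i - 2) (j - 2) :: 'k bipoly set) \<subseteq> bipoly.span D"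
      using bihom_spanned[where ?'k = 'k] by metis
    interpret T: Vector_Spaces.linear scale vscale "\<lambda>y. y *s \<sigma>v"
    proof unfold_locales
      show "(y1 + y2) *s \<sigma>v = y1 *s \<sigma>v + y2 *s \<sigma>v" for y1 y2 by (rule free.scale_left_distrib)
      show "scale c y *s \<sigma>v = vscale c (y *s \<sigma>v)" for c y
        unfolding scale_eq_C vscale_def by (simp only: free.scale_scale)
    qed
    let ?D = "(\<lambda>y. y *s \<sigma>v) ` D"
    have "?gens \<subseteq> bivec.span ?D"
    proof
      fix b assume "b \<in> ?gens"
      from gens[OF this] True obtain y where "b = y *s \<sigma>v" "y \<in> bihom (i - 2) (j - 2)" by metis
      then show "b \<in> bivec.span ?D" using D(3) unfolding T.span_image by blast
    qed
    then have "decomposable f i j \<subseteq> bivec.span ?D"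
      unfolding decomposable_def by (rule bivec.span_minimal) simp
    moreover have "i - 2 + 1 = i - 1" "j - 2 + 1 = j - 1" using True by auto
    then have "card ?D \<le> (i - 1) * (j - 1)"
      using order_trans[OF card_image_le[OF D(1)] D(2)] by metis
    ultimately show ?thesis using True D(1) by (intro exI[of _ ?D]) auto
  next
    case False
    have "?gens \<subseteq> bivec.span {}"
    proof
      fix b assume "b \<in> ?gens"
      from gens[OF this] False have "b = 0 *s \<sigma>v" by metis
      then show "b \<in> bivec.span {}" by simp
    qed
    then have "decomposable f i j \<subseteq> bivec.span {}"
      unfolding decomposable_def by (rule bivec.span_minimal) simp
    then show ?thesis using False by (intro exI[of _ "{}"]) auto
  qed
qed

theorem minimal_syzygies:
  defines "n \<equiv> m + 1"
  shows "has_minimal_first_syzygies n f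
           {#(1, 3 * n),
             (2, 2 * n), (2, 2 * n), (2, 2 * n),
             (3, n + 2),
             (3, 2 * n - 1), (3, 2 * n - 1),
             (6, 2 * n - 2)#}"
proof -
  have n3: "n \<ge> 3" using m by (simp add: n_def)
  from minimal_generators_exist[of f n] f_in obtain B where B: "minimal_bihom_generators n f B"
    and card: "\<And>i j K D. K \<subseteq> syz_piece f i j \<Longrightarrow> bivec.independent K \<Longrightarrow> finite D \<Longrightarrow> decomposable f i j \<subseteq> bivec.span D \<Longrightarrow>
       card K \<le> card {b \<in> B. has_bidegree n b (i + 1, j + n)} + card D"
    unfolding n_def by blast
  \<comment> \<open>The dimension count, with the bound for the decomposable part inserted.\<close>
  have bound: "3 * ((i + 1) * (j + 1)) \<le> card {b \<in> B. has_bidegree n b (k, l)}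
      + (if 2 \<le> i \<and> 2 \<le> j \<and> (i, j) \<noteq> (2, 2) then (i - 1) * (j - 1) else 0) + (i + 2) * (j + n + 1)"
    if "0 < i \<Longrightarrow> j + 2 < n \<or> j + 2 = n \<and> i - 1 \<le> 4 \<or> j + 1 = n \<and> i - 1 = 1 \<or> i - 1 = 0 \<and> j < 2 * n"
      and "0 < j \<Longrightarrow> j + 1 < n \<or> j + 1 = n \<and> i \<le> 4 \<or> j = n \<and> i = 1 \<or> i = 0 \<and> j \<le> 2 * n"
      and kl: "k = i + 1" "l = j + n" for i j k l
  proof -
    have "\<exists>D. finite D \<and> decomposable f i j \<subseteq> bivec.span D \<and>
      card D \<le> (if 2 \<le> i \<and> 2 \<le> j \<and> (i, j) \<noteq> (2, 2) then (i - 1) * (j - 1) else 0)"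
      by (rule decomposable_dim_le) (use that in \<open>auto simp: n_def\<close>)
    then obtain D where D: "finite D" "decomposable f i j \<subseteq> bivec.span D"
      "card D \<le> (if 2 \<le> i \<and> 2 \<le> j \<and> (i, j) \<noteq> (2, 2) then (i - 1) * (j - 1) else 0)" by blast
    from syz_piece_dim_ge[of f 1 "m + 1" i j, OF f_in]
    obtain K where K: "K \<subseteq> syz_piece f i j" "bivec.independent K"
      "3 * ((i + 1) * (j + 1)) \<le> card K + (i + 1 + 1) * (j + (m + 1) + 1)" by blast
    show ?thesis using card[OF K(1,2) D(1,2)] D(3) K(3) unfolding kl by (simp add: n_def)
  qed
  have c1: "1 \<le> card {b \<in> B. has_bidegree n b (1, 3 * n)}"
    using bound[of 0 "2 * n" 1 "3 * n"] by simp
  have c2: "3 \<le> card {b \<in> B. has_bidegree n b (2, 2 * n)}"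
    using bound[of 1 n 2 "2 * n"] n3 by simp
  \<comment> \<open>Here the dimension count gives nothing for large \<open>n\<close>, but the syzygy \<open>\<sigma>\<close> is at hand.\<close>
  have c3: "1 \<le> card {b \<in> B. has_bidegree n b (3, n + 2)}"
  proof -
    have "\<exists>D. finite D \<and> decomposable f 2 2 \<subseteq> bivec.span D \<and>
      card D \<le> (if 2 \<le> (2 :: nat) \<and> 2 \<le> (2 :: nat) \<and> (2 :: nat, 2 :: nat) \<noteq> (2, 2) then (2 - 1) * (2 - 1) else 0)"
      by (rule decomposable_dim_le) (use m in auto)
    then obtain D where D: "finite D" "decomposable f 2 2 \<subseteq> bivec.span D" "card D = 0" by auto
    have "bivec.independent {\<sigma>v}" using \<sigma>v_nonzero by simp
    moreover have "{\<sigma>v} \<subseteq> syz_piece f 2 2" using \<sigma>v_in by simp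
    moreover have "2 + 1 = (3 :: nat)" "2 + n = n + 2" by simp_all
    ultimately show ?thesis using card[of "{\<sigma>v}" 2 2 D] D by simp
  qed
  have c4: "(if n = 3 then 3 else 2) \<le> card {b \<in> B. has_bidegree n b (3, 2 * n - 1)}" (is "_ \<le> ?c")
  proof -
    have "3 * ((2 + 1) * (n - 1 + 1)) \<le> ?c
      + (if 2 \<le> (2 :: nat) \<and> 2 \<le> n - 1 \<and> (2 :: nat, n - 1) \<noteq> (2, 2) then (2 - 1) * (n - 1 - 1) else 0) + (2 + 2) * (n - 1 + n + 1)"
      by (rule bound) (use n3 in auto)
    moreover have "n - 1 + 1 = n" "n - 1 + n + 1 = 2 * n" using n3 by auto
    ultimately show ?thesis using n3 by (auto split: if_splits)
  qed
  have c5: "1 \<le> card {b \<in> B. has_bidegree n b (6, 2 * n - 2)}" (is "_ \<le> ?c")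
  proof -
    have "3 * ((5 + 1) * (n - 2 + 1)) \<le> ?c
      + (if 2 \<le> (5 :: nat) \<and> 2 \<le> n - 2 \<and> (5 :: nat, n - 2) \<noteq> (2, 2) then (5 - 1) * (n - 2 - 1) else 0) + (5 + 2) * (n - 2 + n + 1)"
      by (rule bound) (use n3 in auto)
    then show ?thesis using n3 by (auto split: if_splits)
  qed
  define F where "F d = card {b \<in> B. has_bidegree n b d}" for d
  define D :: "(nat \<times> nat) multiset" where "D = {#(1, 3 * n), (2, 2 * n), (2, 2 * n), (2, 2 * n),
    (3, n + 2), (3, 2 * n - 1), (3, 2 * n - 1), (6, 2 * n - 2)#}"
  have eq: "n + 2 = 2 * n - 1 \<longleftrightarrow> n = 3" "2 * n - 1 = n + 2 \<longleftrightarrow> n = 3" using n3 by auto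
  have "count D d \<le> F d" for d
  proof (cases "d \<in># D")
    case True
    then consider "d = (1, 3 * n)" | "d = (2, 2 * n)" | "d = (3, n + 2)" | "d = (3, 2 * n - 1)" | "d = (6, 2 * n - 2)"
      unfolding D_def by fastforce
    then show ?thesis
    proof cases
      case 1
      then show ?thesis using c1 unfolding F_def[symmetric] D_def by simp
    next
      case 2
      then show ?thesis using c2 unfolding F_def[symmetric] D_def by simp
    next
      case 3
      have "count D d = (if n = 3 then 3 else 1)" unfolding D_def 3 count_add_mset prod.inject eq by simp
      then show ?thesis using c3 c4 3 unfolding F_def[symmetric] by (cases "n = 3") simp_all
    next
      case 4
      have "count D d = (if n = 3 then 3 else 2)" unfolding D_def 4 count_add_mset prod.inject eq by simp
      then show ?thesis using c4 4 unfolding F_def[symmetric] by simp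
    next
      case 5
      then show ?thesis using c5 unfolding F_def[symmetric] D_def by simp
    qed
  qed (simp add: not_in_iff)
  then show ?thesis
    using B unfolding has_minimal_first_syzygies_def D_def F_def by blast
qed

end

section \<open>Base points and normalization of the pencil\<close>

lemma at_point_vanishes_on_span:
  assumes "\<And>p. p \<in> S \<Longrightarrow> at_point r q p = 0" "p \<in> ideal.span (bipoly.span S)"
  shows "at_point r q p = 0"
proof -
  have W: "at_point r q p = 0" if "p \<in> bipoly.span S" for p
    using that by (induction rule: bipoly.span_induct_alt) (simp_all add: scale_eq_C assms(1))
  show ?thesis using assms(2) by (induction rule: ideal.span_induct_alt) (simp_all add: W)
qed

text \<open>At a point of the product of two projective lines, some product of one of \<open>s,t\<close> and one of \<open>u,v\<close> does
  not vanish, and a power of it lies in the ideal.\<close>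

lemma base_point_free_imp_no_common_zero:
  fixes S :: "'k::field bipoly set"
  assumes "basepoint_free (bipoly.span S)" "r \<noteq> (0, 0)" "q \<noteq> (0, 0)"
  shows "\<exists>p\<in>S. at_point r q p \<noteq> 0"
proof (rule ccontr)
  assume "\<not> ?thesis"
  then have 0: "\<And>p. p \<in> S \<Longrightarrow> at_point r q p = 0" by blast
  obtain a where a: "a \<in> {Var_s, Var_t}" "at_point r q (X a) \<noteq> 0"
    using assms(2) by (cases r) fastforce
  obtain b where b: "b \<in> {Var_u, Var_v}" "at_point r q (X b) \<noteq> 0"
    using assms(3) by (cases q) fastforce
  have "X a * X b \<in> ideal.span {X Var_s, X Var_t :: 'k bipoly}"
    using a(1) by (subst mult.commute) (intro ideal.span_scale ideal.span_base, auto)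
  moreover have "X a * X b \<in> ideal.span {X Var_u, X Var_v :: 'k bipoly}"
    using b(1) by (intro ideal.span_scale ideal.span_base) auto
  ultimately have "X a * X b \<in> radical (ideal.span (bipoly.span S))"
    using assms(1) unfolding basepoint_free_def by blast
  then obtain k where "(X a * X b) ^ k \<in> ideal.span (bipoly.span S)" by (auto simp: radical_def)
  from at_point_vanishes_on_span[OF 0 this] have "at_point r q ((X a * X b) ^ k) = 0" by simp
  then show False using a(2) b(2) by simp
qed

lemma ideal_span_bipoly_span: "ideal.span (bipoly.span S) = ideal.span (S :: 'k::field bipoly set)"
proof
  have "bipoly.span S \<subseteq> ideal.span S"
  proof
    fix p assume "p \<in> bipoly.span S"
    then show "p \<in> ideal.span S"
      by (induction rule: bipoly.span_induct_alt)
        (simp_all add: scale_eq_C ideal.span_zero ideal.span_add ideal.span_scale ideal.span_base)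
  qed
  then show "ideal.span (bipoly.span S) \<subseteq> ideal.span S"
    by (rule ideal.span_minimal) simp
  show "ideal.span S \<subseteq> ideal.span (bipoly.span S)"
    by (rule ideal.span_mono) (rule bipoly.span_superset)
qed

lemma nonzero_of_dim_3:
  fixes f :: "3 \<Rightarrow> 'k::field bipoly"
  assumes "bipoly.dim (bipoly.span {f 0, f 1, f 2}) = 3"
  shows "f i \<noteq> 0"
proof
  assume 0: "f i = 0"
  obtain j where "i \<noteq> j" by (metis neq_012(1))
  then obtain k where k: "\<And>l. l = i \<or> l = j \<or> l = k" using third_index by blast
  have "f l \<in> bipoly.span {f j, f k}" for l
    using k[of l] by (elim disjE) (simp_all add: 0 bipoly.span_zero bipoly.span_base)
  then have "{f 0, f 1, f 2} \<subseteq> bipoly.span {f j, f k}" by simp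
  then have "bipoly.dim {f 0, f 1, f 2} \<le> card {f j, f k}" by (intro bipoly.dim_le_card) auto
  also have "\<dots> \<le> 2" by (simp add: card_insert_if)
  finally show False using assms by simp
qed

lemma relation_of_dim_2:
  fixes h :: "3 \<Rightarrow> 'k::field bipoly"
  assumes "bipoly.dim (bipoly.span {h 0, h 1, h 2}) = 2"
  shows "\<exists>c :: 3 \<Rightarrow> 'k. (\<exists>i. c i \<noteq> 0) \<and> C (c 0) * h 0 + C (c 1) * h 1 + C (c 2) * h 2 = 0"
proof (rule ccontr)
  assume no_relation: "\<not> ?thesis"
  have no: "c i = 0" if "(\<Sum>k\<in>UNIV. C (c k) * h k) = 0" for c i
  proof (rule ccontr)
    assume "c i \<noteq> 0"
    then have "\<exists>i. c i \<noteq> 0" ..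
    moreover have "C (c 0) * h 0 + C (c 1) * h 1 + C (c 2) * h 2 = 0" using that unfolding sum_012 .
    ultimately show False using no_relation by blast
  qed
  have inj: "inj h"
  proof (rule injI, rule ccontr)
    fix i j assume ij: "h i = h j" "i \<noteq> j"
    define c where "c = (\<lambda>k. if k = i then 1 else if k = j then - 1 else (0 :: 'k))"
    have "(\<Sum>k\<in>UNIV. C (c k) * h k) = (\<Sum>k\<in>{i, j}. C (c k) * h k)"
      by (rule sum.mono_neutral_right) (auto simp: c_def)
    also have "\<dots> = 0" using ij by (simp add: c_def C_minus)
    finally have "c i = 0" by (rule no)
    then show False by (simp add: c_def)
  qed
  have S: "{h 0, h 1, h 2} = h ` UNIV" unfolding UNIV_3_012 by simp
  have "bipoly.independent (h ` UNIV)"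
  proof (rule bipoly.independent_if_scalars_zero)
    fix d x assume "(\<Sum>x\<in>h ` UNIV. scale (d x) x) = 0" "x \<in> h ` UNIV"
    then show "d x = 0"
      using no[of "\<lambda>k. d (h k)"] by (auto simp: sum.reindex[OF inj] scale_eq_C o_def)
  qed simp
  then have "bipoly.dim (h ` UNIV) = card (h ` UNIV)" by (rule bipoly.dim_eq_card_independent)
  also have "\<dots> = 3" using card_image[OF inj] by simp
  finally show False using assms unfolding S by simp
qed

theorem theorem5p4:
  fixes n :: nat
    and g h :: "3 \<Rightarrow> 'k::alg_closed_field bipoly"
    and W :: "'k bipoly set"
  assumes "n \<ge> 3"
    and "\<And>i. g i \<in> bihom 1 1"
    and "\<And>i. h i \<in> bihom 0 (n - 1)"
    and pencil: "bipoly.dim (bipoly.span {h 0, h 1, h 2}) = 2"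
    and "W = bipoly.span {g 0 * h 0, g 1 * h 1, g 2 * h 2}"
    and "W \<subseteq> bihom 1 n"
    and "bipoly.dim W = 3"
    and "basepoint_free W"
    and "proj W \<inter> Sigma_1 n = {}"
    and "\<exists>P Q T. {P, Q, T} \<subseteq> proj W \<inter> Sigma_3' n \<and> \<not> collinear_points {P, Q, T}"
  shows "(\<exists>a b. ideal.span W =
            ideal.span {g 0 * h 0, g 1 * h 1, g 2 * (scale a (h 0) + scale b (h 1))}) \<and>
         has_minimal_first_syzygies n (\<lambda>i. g i * h i)
           {#(1, 3 * n),
             (2, 2 * n), (2, 2 * n), (2, 2 * n),
             (3, n + 2),
             (3, 2 * n - 1), (3, 2 * n - 1),
             (6, 2 * n - 2)#}"
proof -
  note n3 = assms(1) and g_in = assms(2) and h_in = assms(3) and W = assms(5)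
  have W_range: "{g 0 * h 0, g 1 * h 1, g 2 * h 2} = range (\<lambda>i. g i * h i)"
    unfolding UNIV_3_012 by simp
  have base: "\<exists>i. at_point r q (g i * h i) \<noteq> 0" if "r \<noteq> (0, 0)" "q \<noteq> (0, 0)" for r q
    using base_point_free_imp_no_common_zero[OF assms(8)[unfolded W W_range] that] by auto
  note coprime = no_common_factor_of_base_point_free[of g h, OF g_in base]
  have root: "\<exists>q. q \<noteq> (0, 0) \<and> uv.restr q (h i) = 0" for i
    using uv.root_exists[unfolded uv_piece, of "h i" "n - 2"] h_in[of i] n3 by (simp add: Suc_diff_Suc numeral_2_eq_2)
  obtain c :: "3 \<Rightarrow> 'k" where c: "\<exists>i. c i \<noteq> 0" "C (c 0) * h 0 + C (c 1) * h 1 + C (c 2) * h 2 = 0"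
    using relation_of_dim_2[OF pencil] by blast
  \<comment> \<open>If one coefficient vanished, the other two forms would share a root.\<close>
  have c_nz: "c k \<noteq> 0" for k
  proof
    assume k0: "c k = 0"
    obtain i where i: "c i \<noteq> 0" using c(1) by blast
    then have "i \<noteq> k" using k0 by blast
    then obtain j where j: "j \<noteq> i" "j \<noteq> k" using third_index by blast
    obtain q where q: "q \<noteq> (0, 0)" "uv.restr q (h j) = 0" using root by blast
    have "C (c i) * uv.restr q (h i) = uv.restr q (\<Sum>l\<in>UNIV. C (c l) * h l)"
    proof -
      have "(\<Sum>l\<in>UNIV. C (c l) * h l) = (\<Sum>l\<in>{i, j}. C (c l) * h l)"
        using third_index[OF \<open>i \<noteq> k\<close>] j k0 by (intro sum.mono_neutral_right) auto
      then show ?thesis using j q(2) by simp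
    qed
    also have "\<dots> = 0" unfolding sum_012 c(2) by simp
    finally show False using coprime[OF _ _ j(1) q] i by simp
  qed
  have "ideal.span W = ideal.span {g 0 * h 0, g 1 * h 1, g 2 * (scale (- c 0 / c 2) (h 0) + scale (- c 1 / c 2) (h 1))}"
  proof -
    have "C (c 2) * (scale (- c 0 / c 2) (h 0) + scale (- c 1 / c 2) (h 1)) = C (c 2 * (- c 0 / c 2)) * h 0 + C (c 2 * (- c 1 / c 2)) * h 1"
      unfolding scale_eq_C C_mult by (simp add: algebra_simps)
    also have "\<dots> = C (- c 0) * h 0 + C (- c 1) * h 1" using c_nz[of 2] by simp
    also have "\<dots> = C (c 2) * h 2 - (C (c 0) * h 0 + C (c 1) * h 1 + C (c 2) * h 2)"
      unfolding C_minus by simp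
    also have "\<dots> = C (c 2) * h 2" unfolding c(2) by simp
    finally have "scale (- c 0 / c 2) (h 0) + scale (- c 1 / c 2) (h 1) = h 2" using c_nz[of 2] by simp
    then show ?thesis unfolding W ideal_span_bipoly_span by simp
  qed
  moreover have "has_minimal_first_syzygies n (\<lambda>i. g i * h i)
           {#(1, 3 * n), (2, 2 * n), (2, 2 * n), (2, 2 * n), (3, n + 2),
             (3, 2 * n - 1), (3, 2 * n - 1), (6, 2 * n - 2)#}"
  proof -
    define m where "m = n - 1"
    have nm: "n = m + 1" using n3 by (simp add: m_def)
    have "\<forall>i. \<exists>a b. a \<in> bihom 1 0 \<and> b \<in> bihom 1 0 \<and> g i = X Var_u * a + X Var_v * b"
      using uv.piece_split[unfolded uv_piece, of "g _" 1 0] g_in by simp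
    then obtain a b where ab: "\<And>i. a i \<in> bihom 1 0" "\<And>i. b i \<in> bihom 1 0" "\<And>i. g i = X Var_u * a i + X Var_v * b i"
      by metis
    \<comment> \<open>The coefficients of the relation move from \<open>h\<^sub>i\<close> to \<open>g\<^sub>i\<close>; the products stay the same.\<close>
    define A where "A i = C (1 / c i) * a i" for i
    define B where "B i = C (1 / c i) * b i" for i
    define h' where "h' i = C (c i) * h i" for i
    have gh: "(A i * X Var_u + B i * X Var_v) * h' i = g i * h i" for i
    proof -
      have "(A i * X Var_u + B i * X Var_v) * h' i = (C (1 / c i) * C (c i)) * (g i * h i)"
        unfolding A_def B_def h'_def ab(3) by (simp add: algebra_simps)
      also have "C (1 / c i) * C (c i) = 1" unfolding C_mult[symmetric] using c_nz by simp
      finally show ?thesis by simp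
    qed
    interpret curves A B h' m
    proof
      show "2 \<le> m" using n3 by (simp add: m_def)
      show "A i \<in> bihom 1 0" "B i \<in> bihom 1 0" for i using ab by (simp_all add: A_def B_def bihom_C_mult)
      show "h' i \<in> bihom 0 m" for i using h_in by (simp add: h'_def m_def bihom_C_mult)
      show "h' 0 + h' 1 + h' 2 = 0" using c(2) by (simp add: h'_def)
      show "\<exists>i. at_point r q ((A i * X Var_u + B i * X Var_v) * h' i) \<noteq> 0" if "r \<noteq> (0, 0)" "q \<noteq> (0, 0)" for r q
        unfolding gh using base that by blast
      show "st.restr r (B i) \<noteq> 0" if r: "r \<noteq> (0, 0)" "st.restr r (A i) = 0" for r i
      proof
        assume "st.restr r (B i) = 0"
        then have "st.restr r (a i) = 0" "st.restr r (b i) = 0"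
          using r(2) c_nz by (simp_all add: A_def B_def)
        then obtain \<alpha> \<beta> where \<alpha>\<beta>: "\<alpha> \<in> bihom 0 0" "\<beta> \<in> bihom 0 0" "a i = st.lin r * \<alpha>" "b i = st.lin r * \<beta>"
          using st.lin_divides[unfolded st_piece, OF ab(1) r(1)] st.lin_divides[unfolded st_piece, OF ab(2) r(1)]
          by force
        \<comment> \<open>A factor of \<open>g\<^sub>i\<close> of bidegree \<open>(1,0)\<close> exhibits \<open>f\<^sub>i\<close> as a point of \<open>\<Sigma>\<^bsub>1,n\<^esub>\<close>.\<close>
        define p where "p = (X Var_u * \<alpha> + X Var_v * \<beta>) * h i"
        have f: "g i * h i = st.lin r * p" unfolding ab(3) \<alpha>\<beta>(3,4) p_def by (simp add: algebra_simps)
        have "X Var_u * \<alpha> + X Var_v * \<beta> \<in> bihom 0 1"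
          by (intro bihom_add bihom_mult_eq[OF bihom_X(3) \<alpha>\<beta>(1)] bihom_mult_eq[OF bihom_X(4) \<alpha>\<beta>(2)]) auto
        then have "p \<in> bihom 0 n" unfolding p_def by (rule bihom_mult_eq[OF _ h_in]) (use n3 in auto)
        moreover have "st.lin r \<in> bihom 1 0" using st.lin_piece by simp
        moreover have nz: "g i * h i \<noteq> 0" using nonzero_of_dim_3[of "\<lambda>i. g i * h i"] assms(7) unfolding W by simp
        moreover have "st.lin r \<noteq> 0" "p \<noteq> 0" using nz f by auto
        ultimately have "point (g i * h i) \<in> Sigma_1 n"
          unfolding Sigma_1_def mult_image_def f
          by (intro CollectI exI[of _ "st.lin r"] exI[of _ p]) simp
        moreover have "g i * h i \<in> W" unfolding W W_range by (rule bipoly.span_base) simp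
        ultimately show False using assms(9) nz unfolding proj_def by blast
      qed
    qed
    have "f = (\<lambda>i. g i * h i)" unfolding g_def gh ..
    then show ?thesis using minimal_syzygies unfolding nm by simp
  qed
  ultimately show ?thesis by blast
qed

end
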